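(* Let $H$ be a finitely generated group (with any fixed finite choice of generators) and let $n \in \mathbb{N}$. Then the word problem for $H$ is accepted by a blind $n$-counter automaton if and only if $H$ is virtually free abelian of rank $n$ or less.
   Context: $\mathbb{N}$ denotes the non-negative integers. $X^*$ denotes the free monoid on $X$ and $\epsilon$ the empty word. A (finite) choice of generators for a group $H$ is a surjective monoid morphism $\sigma : X^* \to H$ with $X$ a finite alphabet; the word problem for $H$ with respect to $\sigma$ is the language $\{ w \in X^* \mid w\sigma = 1 \}$. For a monoid $M$ with identity $1$ and a finite alphabet $X$, an $M$-automaton over $X$ is a (non-deterministic) finite automaton over the direct product monoid $M \times X^*$, that is, a finite directed graph whose edges are labelled by elements of $M \times X^*$, with a designated initial state and a set of terminal states; the label of a path is the product of its edge labels. It accepts $w \in X^*$ if there is a path from the initial state to a terminal state labelled $(1,w)$; the language accepted is the set of all accepted words. A blind $n$-counter automaton is a finite state acceptor with $n$ integer counters, initialised to zero, which can be incremented and decremented but not read, and which accepts a word exactly if, reading it, it can reach an accepting state with all counters equal to zero; this is the same thing as a $\mathbb{Z}^n$-automaton. "Virtually free abelian of rank $n$ or less" means having a finite index subgroup isomorphic to $\mathbb{Z}^k$ for some $0 \leq k \leq n$. *)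

theory Defs
  imports "HOL-Algebra.Product_Groups"
begin

definition free_monoid :: "'x set \<Rightarrow> 'x list monoid" where
  "free_monoid S = \<lparr>carrier = lists S, monoid.mult = (@), one = []\<rparr>"

definition monoid_morphism ::
    "('a, 'c) monoid_scheme \<Rightarrow> ('b, 'd) monoid_scheme \<Rightarrow> ('a \<Rightarrow> 'b) \<Rightarrow> bool" where
  "monoid_morphism M N f \<longleftrightarrow> f \<in> hom M N \<and> f \<one>\<^bsub>M\<^esub> = \<one>\<^bsub>N\<^esub>"

definition choice_of_generators ::
    "('h, 'c) monoid_scheme \<Rightarrow> 'x set \<Rightarrow> ('x list \<Rightarrow> 'h) \<Rightarrow> bool" where
  "choice_of_generators H S \<sigma> \<longleftrightarrow>
     finite S \<and> monoid_morphism (free_monoid S) H \<sigma> \<and> \<sigma> ` lists S = carrier H"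

definition word_problem ::
    "('h, 'c) monoid_scheme \<Rightarrow> 'x set \<Rightarrow> ('x list \<Rightarrow> 'h) \<Rightarrow> 'x list set" where
  "word_problem H S \<sigma> = {w \<in> lists S. \<sigma> w = \<one>\<^bsub>H\<^esub>}"

record ('q, 'a) automaton =
  states :: "'q set"
  edges :: "('q \<times> 'a \<times> 'q) set"
  initial :: 'q
  terminals :: "'q set"

definition finite_automaton :: "('a, 'c) monoid_scheme \<Rightarrow> ('q, 'a) automaton \<Rightarrow> bool" where
  "finite_automaton N A \<longleftrightarrow>
     finite (states A) \<and> finite (edges A) \<and>
     edges A \<subseteq> states A \<times> carrier N \<times> states A \<and>
     initial A \<in> states A \<and> terminals A \<subseteq> states A"

inductive labelled_path ::
    "('a, 'c) monoid_scheme \<Rightarrow> ('q, 'a) automaton \<Rightarrow> 'q \<Rightarrow> 'a \<Rightarrow> 'q \<Rightarrow> bool"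
  for N A where
  empty_path: "p \<in> states A \<Longrightarrow> labelled_path N A p \<one>\<^bsub>N\<^esub> p"
| edge_path: "(p, a, q) \<in> edges A \<Longrightarrow> labelled_path N A q b r \<Longrightarrow>
    labelled_path N A p (a \<otimes>\<^bsub>N\<^esub> b) r"

definition monoid_automaton ::
    "('m, 'c) monoid_scheme \<Rightarrow> 'x set \<Rightarrow> ('q, 'm \<times> 'x list) automaton \<Rightarrow> bool" where
  "monoid_automaton M S A \<longleftrightarrow> finite S \<and> finite_automaton (M \<times>\<times> free_monoid S) A"

definition accepted_language ::
    "('m, 'c) monoid_scheme \<Rightarrow> 'x set \<Rightarrow> ('q, 'm \<times> 'x list) automaton \<Rightarrow> 'x list set" where
  "accepted_language M S A =
     {w \<in> lists S. \<exists>t \<in> terminals A.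
        labelled_path (M \<times>\<times> free_monoid S) A (initial A) (\<one>\<^bsub>M\<^esub>, w) t}"

definition Z_power :: "nat \<Rightarrow> (nat \<Rightarrow> int) monoid" where
  "Z_power n = product_group {..<n} (\<lambda>_. integer_group)"

text \<open>A blind \<open>n\<close>-counter automaton is an automaton over \<open>\<int>\<^sup>n\<close>: the \<open>\<int>\<^sup>n\<close>-component of
  an edge label is the change it makes to the counters. Up to renaming, the finitely many
  states are natural numbers.\<close>

definition blind_counter_language :: "nat \<Rightarrow> 'x set \<Rightarrow> 'x list set \<Rightarrow> bool" where
  "blind_counter_language n S L \<longleftrightarrow>
     (\<exists>A :: (nat, (nat \<Rightarrow> int) \<times> 'x list) automaton.
        monoid_automaton (Z_power n) S A \<and> accepted_language (Z_power n) S A = L)"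

definition virtually_free_abelian_le :: "('h, 'c) monoid_scheme \<Rightarrow> nat \<Rightarrow> bool" where
  "virtually_free_abelian_le H n \<longleftrightarrow>
     (\<exists>k \<le> n. \<exists>K. subgroup K H \<and> finite (rcosets\<^bsub>H\<^esub> K) \<and> H\<lparr>carrier := K\<rparr> \<cong> Z_power k)"

end

theory Submission
  imports Defs Complex_Main "HOL-Library.Multiset" "HOL-Library.Function_Algebras"
begin

text \<open>
  If \<open>H\<close> has a finite-index subgroup \<open>K\<close> isomorphic to \<open>\<int>\<^sup>k\<close>, an automaton can follow the coset of \<open>K\<close> in
  its states and keep the \<open>K\<close>-part of the element read so far in its counters (locale
  \<open>coset_automaton\<close>).

  For the converse, consider the automaton as a digraph whose walks have a cost in \<open>\<int>\<^sup>n\<close> and a value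
  in \<open>H\<close>; accepting walks of cost \<open>0\<close> have value \<open>\<one>\<close>. Let \<open>F\<close> be the edge set of an accepting walk
  visiting the state \<open>p\<close>. A loop at \<open>p\<close> inside \<open>F\<close> is compensated if its cost is cancelled by a
  circulation inside \<open>F\<close>. Such a loop and circulation can be inserted into the accepting walk without
  leaving the set of accepting walks, and exchanging the loop for another one of equal cost shows
  that its value depends on its cost only (\<open>loop_value_determined_by_cost\<close>). As costs commute, so do
  the values, and they generate a subgroup of \<open>H\<close>, the loop group of \<open>F\<close> and \<open>p\<close>, which is a
  homomorphic image of a subgroup of \<open>\<int>\<^sup>n\<close> (\<open>loop_group_additive_image\<close>).

  There are finitely many loop groups, and up to conjugation one of them has finite index in \<open>H\<close>
  (\<open>additive_image_of_finite_index\<close>). Otherwise B. H. Neumann's lemma on coverings by cosets yields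
  arbitrarily long sequences \<open>x\<close> in \<open>H\<close> such that no \<open>inv (x i) \<otimes> x j\<close> lies in a conjugate of a loop
  group. The automaton has to accept words passing through such sequences, and whenever a state is
  repeated it produces a loop whose value lies outside all loop groups. But in a walk with many such
  loops at least one is compensated: by Dickson's lemma the walk contains a shorter accepting walk
  with the same edge set, there are more loops than the shorter walk has edges, so one of the loops
  is disjoint from it, and the remaining edges cancel the cost of that loop.

  Finally, a group with a finite-index subgroup that is an image of a subgroup of \<open>\<int>\<^sup>n\<close> is virtually
  free abelian of rank at most \<open>n\<close>: a maximal independent subset of at most \<open>n\<close> generators spans a
  free abelian subgroup of finite index (\<open>additive_image_virtually_free_abelian\<close>).
\<close>

section \<open>Sequences and sums of finite multisets\<close>

lemma nat_sequence_nondecreasing_subsequence: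
  fixes c :: "nat \<Rightarrow> nat"
  shows "\<exists>\<psi>::nat \<Rightarrow> nat. strict_mono \<psi> \<and> (\<forall>i j. i \<le> j \<longrightarrow> c (\<psi> i) \<le> c (\<psi> j))"
proof -
  obtain f :: "nat \<Rightarrow> nat" where f: "strict_mono f" "monoseq (\<lambda>n. c (f n))"
    using seq_monosub by blast
  from f(2) consider (inc) "\<forall>m. \<forall>n\<ge>m. c (f m) \<le> c (f n)" | (dec) "\<forall>m. \<forall>n\<ge>m. c (f n) \<le> c (f m)"
    unfolding monoseq_def by blast
  then show ?thesis
  proof cases
    case inc
    then show ?thesis using f(1) by blast
  next
    case dec
    obtain m where m: "\<And>n. c (f m) \<le> c (f n)"
      using ex_has_least_nat[of "\<lambda>_. True" 0 "\<lambda>n. c (f n)"] by blast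
    have "c (f (m + i)) = c (f m)" for i
      using dec[rule_format, of m "m + i"] m[of "m + i"] by simp
    moreover have "strict_mono (\<lambda>i. f (m + i))"
      using f(1) by (simp add: strict_mono_def)
    ultimately show ?thesis by (intro exI[of _ "\<lambda>i. f (m + i)"]) simp
  qed
qed

text \<open>Dickson's lemma in the form in which it is used: by induction on the alphabet, one passes to a
  subsequence along which the multiplicity of one more letter is nondecreasing.\<close>

lemma dickson_multiset_sequence:
  fixes A :: "nat \<Rightarrow> 'e multiset"
  assumes "finite E" "\<And>i. set_mset (A i) \<subseteq> E"
  shows "\<exists>\<phi>::nat \<Rightarrow> nat. strict_mono \<phi> \<and> (\<forall>i j. i \<le> j \<longrightarrow> A (\<phi> i) \<subseteq># A (\<phi> j))"
  using assms
proof (induction E arbitrary: A rule: finite_induct)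
  case empty
  then have "A i = {#}" for i by simp
  then show ?case by (intro exI[of _ "\<lambda>i::nat. i"]) (simp add: strict_mono_def)
next
  case (insert e E)
  let ?B = "\<lambda>i. filter_mset (\<lambda>x. x \<noteq> e) (A i)"
  have "set_mset (?B i) \<subseteq> E" for i
    using insert.prems[of i] by auto
  from insert.IH[of ?B, OF this] obtain \<phi> :: "nat \<Rightarrow> nat"
    where \<phi>: "strict_mono \<phi>" "\<forall>i j. i \<le> j \<longrightarrow> ?B (\<phi> i) \<subseteq># ?B (\<phi> j)"
    by blast
  from nat_sequence_nondecreasing_subsequence[of "\<lambda>i. count (A (\<phi> i)) e"]
  obtain \<psi> :: "nat \<Rightarrow> nat" where \<psi>: "strict_mono \<psi>"
      "\<forall>i j. i \<le> j \<longrightarrow> count (A (\<phi> (\<psi> i))) e \<le> count (A (\<phi> (\<psi> j))) e"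
    by blast
  have "A (\<phi> (\<psi> i)) \<subseteq># A (\<phi> (\<psi> j))" if "i \<le> j" for i j
  proof (rule mset_subset_eqI)
    fix x
    have "\<psi> i \<le> \<psi> j" using \<psi>(1) that by (simp add: strict_mono_less_eq)
    then have "?B (\<phi> (\<psi> i)) \<subseteq># ?B (\<phi> (\<psi> j))" using \<phi>(2) by blast
    then have "count (?B (\<phi> (\<psi> i))) x \<le> count (?B (\<phi> (\<psi> j))) x"
      by (rule mset_subset_eq_count)
    moreover have "count (A (\<phi> (\<psi> i))) e \<le> count (A (\<phi> (\<psi> j))) e"
      using \<psi>(2) that by blast
    ultimately show "count (A (\<phi> (\<psi> i))) x \<le> count (A (\<phi> (\<psi> j))) x"
      by (cases "x = e") simp_all
  qed
  moreover have "strict_mono (\<lambda>i. \<phi> (\<psi> i))"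
    using \<phi>(1) \<psi>(1) by (simp add: strict_mono_def)
  ultimately show ?case by (intro exI[of _ "\<lambda>i. \<phi> (\<psi> i)"]) simp
qed

text \<open>Each element of \<open>A\<close> has to be found in only one of the summands, so \<open>size A\<close> many of them
  suffice to cover \<open>A\<close>.\<close>

lemma submultiset_sum_meets_few_summands:
  fixes m :: "nat \<Rightarrow> 'e multiset"
  assumes "A \<subseteq># W + (\<Sum>k<N. m k)"
  shows "\<exists>I\<subseteq>{..<N}. card I \<le> size A \<and> A \<subseteq># W + (\<Sum>k\<in>I. m k)"
  using assms
proof (induction N arbitrary: A)
  case 0
  then show ?case by auto
next
  case (Suc N)
  let ?A = "A - m N"
  have "?A \<subseteq># W + (\<Sum>k<N. m k)"
    using Suc.prems by (simp add: subset_eq_diff_conv add.assoc)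
  then obtain I where I: "I \<subseteq> {..<N}" "card I \<le> size ?A" "?A \<subseteq># W + (\<Sum>k\<in>I. m k)"
    using Suc.IH by blast
  show ?case
  proof (cases "?A = A")
    case True
    then show ?thesis using I by (intro exI[of _ I]) auto
  next
    case False
    have "?A \<subset># A" using False by (simp add: subset_mset.less_le)
    then have "size ?A < size A" by (rule mset_subset_size)
    moreover have fin: "finite I" "N \<notin> I" using I(1) finite_subset by auto
    ultimately have "card (insert N I) \<le> size A" using I(2) by simp
    moreover have "A \<subseteq># W + (\<Sum>k\<in>insert N I. m k)"
      using I(3) fin by (simp add: subset_eq_diff_conv ac_simps)
    ultimately show ?thesis using I(1) by (intro exI[of _ "insert N I"]) auto
  qed
qed

text \<open>With more summands than elements of \<open>A\<close>, one of the summands can be set aside entirely while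
  \<open>A\<close> is found in the rest. This is what will free one loop of a long walk from a given short walk
  contained in it.\<close>

lemma submultiset_sum_avoids_summand:
  fixes m :: "nat \<Rightarrow> 'e multiset"
  assumes sub: "A \<subseteq># W + (\<Sum>k<N. m k)" and size: "size A < N"
  shows "\<exists>k<N. A + m k \<subseteq># W + (\<Sum>k<N. m k)"
proof -
  obtain I where I: "I \<subseteq> {..<N}" "card I \<le> size A" "A \<subseteq># W + (\<Sum>k\<in>I. m k)"
    using submultiset_sum_meets_few_summands[OF sub] by blast
  have "\<not> {..<N} \<subseteq> I" using I(1,2) size by (metis card_lessThan leD subset_antisym)
  then obtain k where k: "k < N" "k \<notin> I" by auto
  have fin: "finite I" using I(1) finite_subset by auto
  have "A + m k \<subseteq># W + (\<Sum>k\<in>I. m k) + m k"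
    using I(3) by (simp add: subset_mset.add_right_mono)
  also have "\<dots> = W + (\<Sum>k\<in>insert k I. m k)"
    using k(2) fin by (simp add: ac_simps)
  also have "\<dots> \<subseteq># W + (\<Sum>k<N. m k)"
  proof -
    have "(\<Sum>k<N. m k) = (\<Sum>k\<in>{..<N} - insert k I. m k) + (\<Sum>k\<in>insert k I. m k)"
      using I(1) k(1) by (intro sum.subset_diff) auto
    then show ?thesis by (simp del: sum.insert)
  qed
  finally show ?thesis using k(1) by blast
qed

section \<open>Coverings of a group by cosets\<close>

text \<open>B. H. Neumann's lemma. If \<open>K\<close> has infinite index, some coset \<open>K #> y\<close> is missing from the
  covering; being disjoint from the cosets of \<open>K\<close> that do occur, it is covered by cosets of the
  remaining subgroups, and translating this covering covers every coset of \<open>K\<close>. So \<open>K\<close> can be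
  dropped from the family.\<close>

lemma (in group) neumann_coset_covering:
  assumes "finite \<K>" "\<And>K. K \<in> \<K> \<Longrightarrow> subgroup K G"
    and "finite X" "X \<subseteq> carrier G"
    and "carrier G \<subseteq> (\<Union>K\<in>\<K>. \<Union>x\<in>X. K #> x)"
  shows "\<exists>K\<in>\<K>. finite (rcosets K)"
  using assms
proof (induction \<K> arbitrary: X rule: finite_induct)
  case empty
  then show ?case using one_closed by auto
next
  case (insert K \<K>)
  have K: "subgroup K G" using insert.prems by simp
  show ?case
  proof (cases "finite (rcosets K)")
    case True
    then show ?thesis by simp
  next
    case False
    have "\<not> rcosets K \<subseteq> (\<lambda>x. K #> x) ` X"
      using False insert.prems(2) finite_surj by blast
    then obtain y where y: "y \<in> carrier G" "\<And>x. x \<in> X \<Longrightarrow> K #> y \<noteq> K #> x"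
      unfolding RCOSETS_def by blast
    have disj: "z \<notin> K #> x" if "x \<in> X" "z \<in> K #> y" for x z
    proof
      assume "z \<in> K #> x"
      then have "K #> x = K #> z"
        using repr_independence[of z K x] K that(1) insert.prems(3) by blast
      moreover have "K #> y = K #> z"
        using repr_independence[of z K y] K that(2) y(1) by blast
      ultimately show False using y(2)[OF that(1)] by simp
    qed
    have cov: "\<exists>K'\<in>\<K>. \<exists>x\<in>X. z \<in> K' #> x" if "z \<in> K #> y" for z
    proof -
      have "z \<in> carrier G" using that r_coset_subset_G[OF subgroup.subset[OF K] y(1)] by auto
      then obtain K' x where "K' \<in> insert K \<K>" "x \<in> X" "z \<in> K' #> x"
        using insert.prems(4) by blast
      then show ?thesis using disj[of x z] that by blast
    qed
    define X' where "X' = X \<union> (\<lambda>(x, x'). x' \<otimes> (inv y \<otimes> x)) ` (X \<times> X)"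
    have X': "finite X'" "X' \<subseteq> carrier G"
      using insert.prems(2,3) y(1) by (auto simp: X'_def)
    have "\<exists>K'\<in>\<K>. \<exists>x\<in>X'. z \<in> K' #> x" if z: "z \<in> carrier G" for z
    proof -
      obtain K' x where Kx: "K' \<in> insert K \<K>" "x \<in> X" "z \<in> K' #> x"
        using insert.prems(4) z by blast
      have xc: "x \<in> carrier G" using Kx insert.prems(3) by auto
      show ?thesis
      proof (cases "K' = K")
        case True
        obtain k where k: "k \<in> K" "z = k \<otimes> x" using Kx True by (auto simp: r_coset_def)
        have kc: "k \<in> carrier G" by (rule subgroup.mem_carrier[OF K k(1)])
        have "k \<otimes> y \<in> K #> y" using k(1) by (auto simp: r_coset_def)
        then obtain L x' where L: "L \<in> \<K>" "x' \<in> X" "k \<otimes> y \<in> L #> x'" using cov by blast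
        then obtain l where l: "l \<in> L" "k \<otimes> y = l \<otimes> x'" by (auto simp: r_coset_def)
        have lc: "l \<in> carrier G"
          using subgroup.mem_carrier[OF insert.prems(1) l(1)] L(1) by simp
        have x'c: "x' \<in> carrier G" using L insert.prems(3) by auto
        have "z = (k \<otimes> y) \<otimes> (inv y \<otimes> x)"
          using kc y(1) xc k(2) by (simp add: m_assoc flip: m_assoc[of y])
        also have "\<dots> = l \<otimes> (x' \<otimes> (inv y \<otimes> x))"
          using l(2) lc x'c y(1) xc by (simp add: m_assoc)
        finally have "z \<in> L #> (x' \<otimes> (inv y \<otimes> x))" using l(1) by (auto simp: r_coset_def)
        moreover have "x' \<otimes> (inv y \<otimes> x) \<in> X'" using L(2) Kx(2) by (auto simp: X'_def)
        ultimately show ?thesis using L(1) by blast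
      next
        case False
        then show ?thesis using Kx by (auto simp: X'_def)
      qed
    qed
    then have "carrier G \<subseteq> (\<Union>K\<in>\<K>. \<Union>x\<in>X'. K #> x)" by blast
    with insert.IH[OF _ X'] insert.prems(1) have "\<exists>K\<in>\<K>. finite (rcosets K)" by simp
    then show ?thesis by simp
  qed
qed

text \<open>Choosing \<open>x j\<close> amounts to leaving finitely many cosets of members of \<open>\<K>\<close>, which is possible
  because by Neumann's lemma they cannot cover the group.\<close>

lemma (in group) sequence_avoiding_subgroups:
  assumes "finite \<K>" "\<And>K. K \<in> \<K> \<Longrightarrow> subgroup K G" "\<And>K. K \<in> \<K> \<Longrightarrow> infinite (rcosets K)"
  shows "\<exists>x. (\<forall>i::nat. x i \<in> carrier G) \<and>
    (\<forall>j\<le>N. \<forall>i<j. \<forall>K\<in>\<K>. inv (x i) \<otimes> x j \<notin> K)"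
proof (induction N)
  case 0
  then show ?case by (intro exI[of _ "\<lambda>_. \<one>"]) auto
next
  case (Suc N)
  then obtain x where "(\<forall>i. x i \<in> carrier G) \<and>
      (\<forall>j\<le>N. \<forall>i<j. \<forall>K\<in>\<K>. inv (x i) \<otimes> x j \<notin> K)" ..
  then have x: "\<And>i. x i \<in> carrier G"
      "\<And>i j K. j \<le> N \<Longrightarrow> i < j \<Longrightarrow> K \<in> \<K> \<Longrightarrow> inv (x i) \<otimes> x j \<notin> K" by auto
  let ?X = "(\<lambda>i. inv (x i)) ` {..N}"
  have X: "finite ?X" "?X \<subseteq> carrier G" using x(1) by auto
  have "\<not> carrier G \<subseteq> (\<Union>K\<in>\<K>. \<Union>x\<in>?X. K #> x)"
  proof
    assume "carrier G \<subseteq> (\<Union>K\<in>\<K>. \<Union>x\<in>?X. K #> x)"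
    from neumann_coset_covering[OF assms(1,2) X this] show False using assms(3) by auto
  qed
  then obtain z where zc: "z \<in> carrier G" and "z \<notin> (\<Union>K\<in>\<K>. \<Union>x\<in>?X. K #> x)" by (meson subsetI) 
  then have z: "z \<in> carrier G" "\<And>K i. K \<in> \<K> \<Longrightarrow> i \<le> N \<Longrightarrow> z \<notin> K #> inv (x i)" by auto
  have "inv (x i) \<otimes> inv z \<notin> K" if "K \<in> \<K>" "i \<le> N" for K i
  proof
    assume "inv (x i) \<otimes> inv z \<in> K"
    then have "inv (inv (x i) \<otimes> inv z) \<in> K" using subgroup.m_inv_closed[OF assms(2)] that by simp
    then have "z \<otimes> x i \<in> K" using z(1) x(1) by (simp add: inv_mult_group)
    moreover have "z = (z \<otimes> x i) \<otimes> inv (x i)" using z(1) x(1) by (simp add: m_assoc)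
    ultimately have "z \<in> K #> inv (x i)" unfolding r_coset_def by blast
    then show False using z(2) that by blast
  qed
  then have "\<forall>j\<le>Suc N. \<forall>i<j. \<forall>K\<in>\<K>. inv ((x(Suc N := inv z)) i) \<otimes> (x(Suc N := inv z)) j \<notin> K"
    using x(2) by (simp add: le_Suc_eq less_Suc_eq_le)
  then show ?case
    using x(1) zc by (intro exI[of _ "x(Suc N := inv z)"]) simp
qed

section \<open>Walks and balanced multisets of edges\<close>

locale finite_digraph =
  fixes E :: "'e set" and src tgt :: "'e \<Rightarrow> 'q"
  assumes finite_edges: "finite E"
begin

primrec walk :: "'q \<Rightarrow> 'e list \<Rightarrow> 'q \<Rightarrow> bool" where
  "walk p [] q \<longleftrightarrow> p = q"
| "walk p (e # es) q \<longleftrightarrow> e \<in> E \<and> src e = p \<and> walk (tgt e) es q"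

text \<open>A balanced multiset is an integral circulation: what is left of a walk when a walk with the same
  ends is taken out of it. Recording only how often each edge is used makes it possible to add and
  subtract walks.\<close>

definition balanced :: "'e multiset \<Rightarrow> bool" where
  "balanced Z \<longleftrightarrow> image_mset src Z = image_mset tgt Z"

lemma walk_append: "walk p (xs @ ys) r \<longleftrightarrow> (\<exists>q. walk p xs q \<and> walk q ys r)"
  by (induction xs arbitrary: p) auto

lemma walk_edges: "walk p es q \<Longrightarrow> set es \<subseteq> E"
  by (induction es arbitrary: p) auto

lemma walk_determines_end: "walk p es q \<Longrightarrow> walk p es r \<Longrightarrow> q = r"
  by (induction es arbitrary: p) auto

lemma walk_end_visited: "walk p es q \<Longrightarrow> q \<in> insert p (tgt ` set es)"
  by (induction es arbitrary: p) auto

lemma walk_balance: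
  "walk p es q \<Longrightarrow> image_mset src (mset es) + {#q#} = image_mset tgt (mset es) + {#p#}"
proof (induction es arbitrary: p)
  case (Cons e es)
  then show ?case using Cons.IH[of "tgt e"] by auto
qed simp

lemma walk_split_at_visited:
  assumes "walk p es q" "r \<in> insert p (tgt ` set es)"
  shows "\<exists>xs ys. es = xs @ ys \<and> walk p xs r \<and> walk r ys q"
  using assms
proof (induction es arbitrary: p)
  case (Cons e es)
  show ?case
  proof (cases "r = p")
    case True
    then show ?thesis using Cons.prems by (intro exI[of _ "[]"] exI[of _ "e # es"]) simp
  next
    case False
    then obtain xs ys where "es = xs @ ys" "walk (tgt e) xs r" "walk r ys q"
      using Cons.IH[of "tgt e"] Cons.prems by auto
    then show ?thesis using Cons.prems by (intro exI[of _ "e # xs"] exI[of _ ys]) simp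
  qed
qed simp

lemma walk_source_visited:
  assumes "walk p es q" "e \<in> set es"
  shows "src e \<in> insert p (tgt ` set es)"
proof -
  obtain xs ys where es: "es = xs @ e # ys" using assms(2) by (auto dest: split_list)
  then have "walk p xs (src e)" using assms(1) by (auto simp: walk_append)
  then show ?thesis using walk_end_visited es by fastforce
qed

text \<open>Follow unused edges greedily: as long as the current vertex is not \<open>q\<close>, the balance condition
  provides one more unused edge leaving it.\<close>

lemma walk_along_unbalanced_edges:
  assumes "image_mset src Z + {#q#} = image_mset tgt Z + {#p#}" "set_mset Z \<subseteq> E"
  shows "\<exists>es. walk p es q \<and> mset es \<subseteq># Z"
  using assms
proof (induction "size Z" arbitrary: Z p)
  case 0
  then show ?case by (intro exI[of _ "[]"]) auto
next
  case (Suc n)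
  show ?case
  proof (cases "p = q")
    case True
    then show ?thesis by (intro exI[of _ "[]"]) simp
  next
    case False
    have "p \<in># image_mset src Z + {#q#}" using Suc.prems(1) by simp
    then obtain e where e: "e \<in># Z" "src e = p" using False by auto
    then obtain Z' where Z: "Z = add_mset e Z'" by (auto dest: multi_member_split)
    then have "image_mset src Z' + {#q#} = image_mset tgt Z' + {#tgt e#}"
      using Suc.prems(1) e(2) by (auto simp: add_mset_commute)
    then obtain es where "walk (tgt e) es q" "mset es \<subseteq># Z'"
      using Suc.hyps(1)[of Z' "tgt e"] Suc.hyps(2) Suc.prems(2) Z by auto
    then show ?thesis using e Z Suc.prems(2) by (intro exI[of _ "e # es"]) auto
  qed
qed

text \<open>Euler's theorem for directed multigraphs, in relative form. A circulation supported on the edges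
  of a walk splits into closed walks, each starting at a vertex that the walk visits, and these can
  be spliced in one after the other.\<close>

lemma walk_absorbs_balanced:
  assumes "walk s es t" "balanced Z" "set_mset Z \<subseteq> set es"
  shows "\<exists>es'. walk s es' t \<and> mset es' = mset es + Z"
  using assms
proof (induction "size Z" arbitrary: Z es rule: less_induct)
  case less
  show ?case
  proof (cases "Z = {#}")
    case True
    then show ?thesis using less.prems(1) by auto
  next
    case False
    then obtain e where e: "e \<in># Z" by auto
    then obtain Z' where Z: "Z = add_mset e Z'" by (auto dest: multi_member_split)
    have E: "set_mset Z \<subseteq> E" using less.prems(1,3) walk_edges by blast
    have "image_mset src Z' + {#src e#} = image_mset tgt Z' + {#tgt e#}"
      using less.prems(2) Z by (simp add: balanced_def)
    then obtain us where us: "walk (tgt e) us (src e)" "mset us \<subseteq># Z'"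
      using walk_along_unbalanced_edges[of Z' "src e" "tgt e"] E Z by auto
    then obtain Y where Y: "Z' = mset us + Y" by (metis mset_subset_eq_exists_conv)
    have "(image_mset src (mset us) + {#src e#}) + image_mset src Y =
          (image_mset src (mset us) + {#src e#}) + image_mset tgt Y"
    proof -
      have "(image_mset src (mset us) + {#src e#}) + image_mset src Y = image_mset src Z"
        using Z Y by simp
      also have "\<dots> = (image_mset tgt (mset us) + {#tgt e#}) + image_mset tgt Y"
        using less.prems(2) Z Y by (simp add: balanced_def)
      finally show ?thesis by (simp only: walk_balance[OF us(1)])
    qed
    then have "balanced Y" unfolding balanced_def by (simp only: add_left_cancel)
    have "src e \<in> insert s (tgt ` set es)"
      using walk_source_visited[OF less.prems(1)] e less.prems(3) by blast
    then obtain xs ys where xy: "es = xs @ ys" "walk s xs (src e)" "walk (src e) ys t"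
      using walk_split_at_visited[OF less.prems(1)] by blast
    let ?es = "xs @ (e # us) @ ys"
    have "walk (src e) (e # us) (src e)" using us(1) e E by auto
    then have "walk s ?es t" using xy(2,3) walk_append by blast
    moreover have "set_mset Y \<subseteq> set ?es" using less.prems(3) Z Y xy(1) by auto
    moreover have "size Y < size Z" using Z Y by simp
    ultimately obtain es' where "walk s es' t" "mset es' = mset ?es + Y"
      using less.hyps \<open>balanced Y\<close> by blast
    then show ?thesis using Z Y xy(1) by (intro exI[of _ es']) simp
  qed
qed

lemma walk_segment:
  assumes "walk s (take i es) p" "walk s (take j es) p" "i \<le> j"
  shows "walk p (drop i (take j es)) p" "take j es = take i es @ drop i (take j es)"
proof -
  show *: "take j es = take i es @ drop i (take j es)"
    using assms(3) append_take_drop_id[of i "take j es"] by (simp add: min_def)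
  show "walk p (drop i (take j es)) p"
    using assms(1,2) walk_determines_end unfolding * [symmetric]
    by (metis * walk_append)
qed

end

section \<open>Additive images\<close>

definition additive_subgroup :: "'a::ab_group_add set \<Rightarrow> bool" where
  "additive_subgroup A \<longleftrightarrow> 0 \<in> A \<and> (\<forall>a\<in>A. \<forall>b\<in>A. a - b \<in> A)"

text \<open>The set \<open>B\<close> confines the homomorphism to a group without a type of its own, here \<open>\<int>\<^sup>n\<close> inside the
  additive group of all functions from naturals to integers.\<close>

definition additive_image ::
    "('h, 'c) monoid_scheme \<Rightarrow> 'a::ab_group_add set \<Rightarrow> 'h set \<Rightarrow> bool" where
  "additive_image H B K \<longleftrightarrow> (\<exists>A f. additive_subgroup A \<and> A \<subseteq> B \<and> f \<in> A \<rightarrow> carrier H \<and>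
     (\<forall>a\<in>A. \<forall>b\<in>A. f (a + b) = f a \<otimes>\<^bsub>H\<^esub> f b) \<and> K = f ` A)"

lemma additive_subgroup_add:
  assumes "additive_subgroup A" "a \<in> A" "b \<in> A"
  shows "a + b \<in> A"
proof -
  have "a - (0 - b) \<in> A" using assms unfolding additive_subgroup_def by blast
  then show ?thesis by simp
qed

context group
begin

lemma additive_image_subgroup:
  assumes "additive_image G B K"
  shows "subgroup K G"
proof -
  obtain A f where A: "additive_subgroup A" "A \<subseteq> B" "f \<in> A \<rightarrow> carrier G"
      "\<forall>a\<in>A. \<forall>b\<in>A. f (a + b) = f a \<otimes> f b" "K = f ` A"
    using assms unfolding additive_image_def by blast
  have z: "0 \<in> A" using A(1) by (simp add: additive_subgroup_def)
  then have "f 0 \<otimes> f 0 = f 0" using A(4)[rule_format, of 0 0] by simp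
  then have f0: "f 0 = \<one>" using A(3) z by (auto simp: Pi_def)
  show ?thesis
  proof (rule subgroupI)
    show "K \<subseteq> carrier G" "K \<noteq> {}" using A(3,5) z by auto
    show "a \<otimes> b \<in> K" if ab: "a \<in> K" "b \<in> K" for a b
    proof -
      obtain x y where xy: "x \<in> A" "y \<in> A" "a = f x" "b = f y" using ab A(5) by auto
      have "a \<otimes> b = f (x + y)" using xy A(4) by simp
      then show ?thesis using additive_subgroup_add[OF A(1) xy(1,2)] A(5) by blast
    qed
    show "inv a \<in> K" if a: "a \<in> K" for a
    proof -
      obtain x where x: "x \<in> A" "a = f x" using a A(5) by auto
      have m: "0 - x \<in> A" using A(1) z x(1) unfolding additive_subgroup_def by blast
      have "f (0 - x) \<otimes> f x = \<one>" using A(4)[rule_format, OF m x(1)] f0 by simp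
      then have "inv a = f (0 - x)" using x m A(3) by (intro inv_equality) auto
      then show ?thesis using m A(5) by blast
    qed
  qed
qed

lemma additive_image_conjugate:
  assumes "additive_image G B K" "g \<in> carrier G"
  shows "additive_image G B ((\<lambda>k. g \<otimes> k \<otimes> inv g) ` K)"
proof -
  obtain A f where A: "additive_subgroup A" "A \<subseteq> B" "f \<in> A \<rightarrow> carrier G"
      "\<forall>a\<in>A. \<forall>b\<in>A. f (a + b) = f a \<otimes> f b" "K = f ` A"
    using assms(1) unfolding additive_image_def by blast
  let ?f = "\<lambda>a. g \<otimes> f a \<otimes> inv g"
  have "?f (a + b) = ?f a \<otimes> ?f b" if "a \<in> A" "b \<in> A" for a b
  proof -
    have "f a \<in> carrier G" "f b \<in> carrier G" using that A(3) by auto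
    then show ?thesis using assms(2) A(4)[rule_format, OF that]
      by (simp add: m_assoc) (simp add: flip: m_assoc[of "inv g" g])
  qed
  moreover have "?f \<in> A \<rightarrow> carrier G" using A(3) assms(2) by auto
  moreover have "(\<lambda>k. g \<otimes> k \<otimes> inv g) ` K = ?f ` A" using A(5) by auto
  ultimately show ?thesis using A(1,2) unfolding additive_image_def by blast
qed

end

section \<open>Loops in an automaton over an abelian group\<close>

text \<open>Edges carry a change of the counters (\<open>cost\<close>) and the group element represented by the word that
  is read (\<open>val\<close>). Only the cost is independent of the order of the edges, so it is defined on
  multisets.\<close>

locale group_labelled_digraph = group H + finite_digraph E src tgt
  for H :: "('h, 'c) monoid_scheme" (structure)
    and E :: "'e set" and src tgt :: "'e \<Rightarrow> 'q" +
  fixes cost :: "'e \<Rightarrow> 'a::ab_group_add" and val :: "'e \<Rightarrow> 'h"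
  assumes val_closed: "val e \<in> carrier H"
begin

primrec value_of :: "'e list \<Rightarrow> 'h" where
  "value_of [] = \<one>"
| "value_of (e # es) = val e \<otimes> value_of es"

definition total_cost :: "'e multiset \<Rightarrow> 'a" where
  "total_cost Z = (\<Sum>e\<in>#Z. cost e)"

lemma value_of_closed [simp]: "value_of es \<in> carrier H"
  by (induction es) (simp_all add: val_closed)

lemma value_of_append: "value_of (xs @ ys) = value_of xs \<otimes> value_of ys"
  by (induction xs) (simp_all add: val_closed m_assoc)

lemma total_cost_add [simp]: "total_cost (Y + Z) = total_cost Y + total_cost Z"
  by (simp add: total_cost_def)

lemma total_cost_empty [simp]: "total_cost {#} = 0"
  by (simp add: total_cost_def)

end

text \<open>The assumption \<open>accepted_value\<close> is the half of the word problem condition saying that accepted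
  words represent the identity.\<close>

locale abelian_automaton = group_labelled_digraph H E src tgt cost val
  for H :: "('h, 'c) monoid_scheme" (structure)
    and E :: "'e set" and src tgt :: "'e \<Rightarrow> 'q"
    and cost :: "'e \<Rightarrow> 'a::ab_group_add" and val :: "'e \<Rightarrow> 'h" +
  fixes init :: 'q and T :: "'q set" and B :: "'a set"
  assumes finite_terminals: "finite T"
    and B: "additive_subgroup B"
    and cost_in_B: "e \<in> E \<Longrightarrow> cost e \<in> B"
    and accepted_value: "walk init es t \<Longrightarrow> t \<in> T \<Longrightarrow> total_cost (mset es) = 0 \<Longrightarrow> value_of es = \<one>"
begin

definition accepting :: "'e list \<Rightarrow> bool" where
  "accepting es \<longleftrightarrow> (\<exists>t\<in>T. walk init es t) \<and> total_cost (mset es) = 0"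

definition visited :: "'e set \<Rightarrow> 'q set" where
  "visited F = insert init (tgt ` F)"

text \<open>The loops at \<open>p\<close> inside the edge set \<open>F\<close> whose cost can be cancelled by a circulation inside \<open>F\<close>.
  If \<open>F\<close> is the set of edges of an accepting walk through \<open>p\<close>, then the loop and the
  circulation together can be inserted into that walk. The condition depends on \<open>F\<close> and \<open>p\<close> only, hence there are just
  finitely many such sets of loops.\<close>

definition compensated_loops :: "'e set \<Rightarrow> 'q \<Rightarrow> 'e list set" where
  "compensated_loops F p = {\<gamma>. walk p \<gamma> p \<and> set \<gamma> \<subseteq> F \<and>
     (\<exists>Z. balanced Z \<and> set_mset Z \<subseteq> F \<and> total_cost (mset \<gamma>) + total_cost Z = 0)}"

definition loop_group :: "'e set \<Rightarrow> 'q \<Rightarrow> 'h set" where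
  "loop_group F p = {value_of \<gamma> \<otimes> inv (value_of \<delta>) | \<gamma> \<delta>.
     \<gamma> \<in> compensated_loops F p \<and> \<delta> \<in> compensated_loops F p}"

lemma total_cost_in_B: "set_mset Z \<subseteq> E \<Longrightarrow> total_cost Z \<in> B"
proof (induction Z)
  case empty
  then show ?case using B by (simp add: additive_subgroup_def)
next
  case (add e Z)
  then show ?case
    using additive_subgroup_add[OF B cost_in_B] by (simp add: total_cost_def)
qed

lemma compensated_loops_append:
  assumes "\<gamma> \<in> compensated_loops F p" "\<delta> \<in> compensated_loops F p"
  shows "\<gamma> @ \<delta> \<in> compensated_loops F p"
proof -
  obtain Y Z where
      Y: "balanced Y" "set_mset Y \<subseteq> F" "total_cost (mset \<gamma>) + total_cost Y = 0" and
      Z: "balanced Z" "set_mset Z \<subseteq> F" "total_cost (mset \<delta>) + total_cost Z = 0"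
    using assms unfolding compensated_loops_def by blast
  have "total_cost (mset (\<gamma> @ \<delta>)) + total_cost (Y + Z) =
      (total_cost (mset \<gamma>) + total_cost Y) + (total_cost (mset \<delta>) + total_cost Z)"
    by (simp add: ac_simps)
  then have "total_cost (mset (\<gamma> @ \<delta>)) + total_cost (Y + Z) = 0" using Y(3) Z(3) by simp
  moreover have "balanced (Y + Z)" "set_mset (Y + Z) \<subseteq> F"
    using Y Z by (auto simp: balanced_def)
  moreover have "walk p (\<gamma> @ \<delta>) p" "set (\<gamma> @ \<delta>) \<subseteq> F"
    using assms by (auto simp: compensated_loops_def walk_append)
  ultimately show ?thesis unfolding compensated_loops_def by blast
qed

lemma Nil_in_compensated_loops: "[] \<in> compensated_loops F p"
proof -
  have "balanced {#}" by (simp add: balanced_def)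
  then show ?thesis by (auto simp: compensated_loops_def intro!: exI[of _ "{#}"])
qed

text \<open>Insert \<open>\<gamma>\<close> and the circulation cancelling it into the accepting walk \<open>es\<close>. The result is accepting,
  and stays accepting when \<open>\<gamma>\<close> is replaced by a loop \<open>\<delta>\<close> at \<open>p\<close> of the same cost. Both walks have value
  \<open>\<one>\<close> and differ only in this factor.\<close>

lemma loop_value_determined_by_cost:
  assumes es: "accepting es" "p \<in> visited (set es)"
    and \<gamma>: "\<gamma> \<in> compensated_loops (set es) p"
    and \<delta>: "walk p \<delta> p" "total_cost (mset \<delta>) = total_cost (mset \<gamma>)"
  shows "value_of \<delta> = value_of \<gamma>"
proof -
  obtain t where t: "t \<in> T" "walk init es t" "total_cost (mset es) = 0"
    using es(1) by (auto simp: accepting_def)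
  obtain Z where Z: "balanced Z" "set_mset Z \<subseteq> set es" "total_cost (mset \<gamma>) + total_cost Z = 0"
    and \<gamma>w: "walk p \<gamma> p"
    using \<gamma> by (auto simp: compensated_loops_def)
  obtain us where us: "walk init us t" "mset us = mset es + Z"
    using walk_absorbs_balanced[OF t(2) Z(1,2)] by blast
  have "set es \<subseteq> set us" using arg_cong[OF us(2), of set_mset] by auto
  then have "p \<in> insert init (tgt ` set us)" using es(2) by (auto simp: visited_def)
  then obtain xs ys where xy: "us = xs @ ys" "walk init xs p" "walk p ys t"
    using walk_split_at_visited[OF us(1)] by blast
  have value1: "value_of xs \<otimes> (value_of \<eta> \<otimes> value_of ys) = \<one>"
    if \<eta>: "walk p \<eta> p" "total_cost (mset \<eta>) = total_cost (mset \<gamma>)" for \<eta>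
  proof -
    have "mset xs + mset ys = mset es + Z" using xy(1) us(2) by simp
    moreover have "mset (xs @ \<eta> @ ys) = (mset xs + mset ys) + mset \<eta>" by simp
    ultimately have "total_cost (mset (xs @ \<eta> @ ys)) =
        total_cost (mset es) + total_cost Z + total_cost (mset \<eta>)"
      by (simp only: total_cost_add)
    also have "\<dots> = 0" using t(3) Z(3) \<eta>(2) by (simp add: add.commute)
    finally have "total_cost (mset (xs @ \<eta> @ ys)) = 0" .
    moreover have "walk init (xs @ \<eta> @ ys) t" using xy(2,3) \<eta>(1) walk_append by blast
    ultimately show ?thesis
      using accepted_value[of "xs @ \<eta> @ ys" t] t(1) by (simp add: value_of_append)
  qed
  have "value_of xs \<otimes> (value_of \<delta> \<otimes> value_of ys) = value_of xs \<otimes> (value_of \<gamma> \<otimes> value_of ys)"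
    using value1[OF \<delta>] value1[OF \<gamma>w] by simp
  then show ?thesis by simp
qed

text \<open>Since the value of a compensated loop is a function of its cost, the values of two such loops
  commute, and sending the cost of a loop to its value extends to differences of costs.\<close>

lemma loop_group_additive_image:
  assumes es: "accepting es" "p \<in> visited (set es)"
  shows "additive_image H B (loop_group (set es) p)"
proof -
  let ?M = "compensated_loops (set es) p"
  let ?c = "\<lambda>\<gamma>. total_cost (mset \<gamma>)" and ?v = value_of
  have det: "?v \<gamma> = ?v \<delta>" if "\<gamma> \<in> ?M" "\<delta> \<in> ?M" "?c \<gamma> = ?c \<delta>" for \<gamma> \<delta>
    using loop_value_determined_by_cost[OF es that(2), of \<gamma>] that by (auto simp: compensated_loops_def)
  have comm: "?v \<gamma> \<otimes> ?v \<delta> = ?v \<delta> \<otimes> ?v \<gamma>" if "\<gamma> \<in> ?M" "\<delta> \<in> ?M" for \<gamma> \<delta>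
    using det[of "\<gamma> @ \<delta>" "\<delta> @ \<gamma>"] compensated_loops_append that
    by (simp add: value_of_append add.commute)
  have inv_comm: "inv (?v \<delta>) \<otimes> ?v \<gamma> = ?v \<gamma> \<otimes> inv (?v \<delta>)" if "\<gamma> \<in> ?M" "\<delta> \<in> ?M" for \<gamma> \<delta>
  proof -
    have "?v \<delta> \<otimes> (?v \<gamma> \<otimes> inv (?v \<delta>)) = (?v \<gamma> \<otimes> ?v \<delta>) \<otimes> inv (?v \<delta>)"
      unfolding comm[OF that] by (simp add: m_assoc)
    also have "\<dots> = ?v \<gamma>" by (simp add: m_assoc)
    finally have "?v \<gamma> \<otimes> inv (?v \<delta>) = inv (?v \<delta>) \<otimes> ?v \<gamma>"
      by (simp add: inv_solve_left)
    then show ?thesis by simp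
  qed
  define A where "A = {?c \<gamma> - ?c \<delta> | \<gamma> \<delta>. \<gamma> \<in> ?M \<and> \<delta> \<in> ?M}"
  \<comment> \<open>The choice is immaterial: \<open>?v \<gamma> \<otimes> inv (?v \<delta>)\<close> depends only on \<open>?c \<gamma> - ?c \<delta>\<close>, by comparing the
     loops \<open>\<delta> @ \<gamma>'\<close> and \<open>\<gamma> @ \<delta>'\<close> of equal cost.\<close>
  define f where "f a = (SOME g. \<exists>\<gamma>\<in>?M. \<exists>\<delta>\<in>?M. a = ?c \<gamma> - ?c \<delta> \<and> g = ?v \<gamma> \<otimes> inv (?v \<delta>))" for a
  have f: "f (?c \<gamma> - ?c \<delta>) = ?v \<gamma> \<otimes> inv (?v \<delta>)" if M: "\<gamma> \<in> ?M" "\<delta> \<in> ?M" for \<gamma> \<delta>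
    unfolding f_def
  proof (rule some_equality)
    show "\<exists>\<gamma>'\<in>?M. \<exists>\<delta>'\<in>?M. ?c \<gamma> - ?c \<delta> = ?c \<gamma>' - ?c \<delta>' \<and> ?v \<gamma> \<otimes> inv (?v \<delta>) = ?v \<gamma>' \<otimes> inv (?v \<delta>')"
      using M by blast
    fix g
    assume "\<exists>\<gamma>'\<in>?M. \<exists>\<delta>'\<in>?M. ?c \<gamma> - ?c \<delta> = ?c \<gamma>' - ?c \<delta>' \<and> g = ?v \<gamma>' \<otimes> inv (?v \<delta>')"
    then obtain \<gamma>' \<delta>' where M': "\<gamma>' \<in> ?M" "\<delta>' \<in> ?M" and c: "?c \<gamma> - ?c \<delta> = ?c \<gamma>' - ?c \<delta>'"
      and g: "g = ?v \<gamma>' \<otimes> inv (?v \<delta>')" by blast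
    have "?c (\<delta> @ \<gamma>') = ?c (\<gamma> @ \<delta>')" using c by (simp add: algebra_simps)
    then have "?v \<delta> \<otimes> ?v \<gamma>' = ?v \<gamma> \<otimes> ?v \<delta>'"
      using det[of "\<delta> @ \<gamma>'" "\<gamma> @ \<delta>'"] compensated_loops_append M M' by (simp add: value_of_append)
    then have "?v \<gamma>' = inv (?v \<delta>) \<otimes> (?v \<gamma> \<otimes> ?v \<delta>')" by (simp add: inv_solve_left)
    then have "g = inv (?v \<delta>) \<otimes> ?v \<gamma>" unfolding g by (simp add: m_assoc)
    then show "g = ?v \<gamma> \<otimes> inv (?v \<delta>)" using inv_comm M by simp
  qed
  have "additive_subgroup A"
    unfolding additive_subgroup_def
  proof (intro conjI ballI)
    show "0 \<in> A" unfolding A_def using Nil_in_compensated_loops[of "set es" p]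
      by (auto intro!: exI[of _ "[]"])
    fix a b
    assume "a \<in> A" "b \<in> A"
    then obtain \<gamma> \<delta> \<gamma>' \<delta>' where M: "\<gamma> \<in> ?M" "\<delta> \<in> ?M" "\<gamma>' \<in> ?M" "\<delta>' \<in> ?M"
      and ab: "a = ?c \<gamma> - ?c \<delta>" "b = ?c \<gamma>' - ?c \<delta>'" unfolding A_def by blast
    have "a - b = ?c (\<gamma> @ \<delta>') - ?c (\<delta> @ \<gamma>')" using ab by simp
    then show "a - b \<in> A" unfolding A_def using M compensated_loops_append by blast
  qed
  moreover have "A \<subseteq> B"
  proof
    fix a
    assume "a \<in> A"
    then obtain \<gamma> \<delta> where M: "\<gamma> \<in> ?M" "\<delta> \<in> ?M" "a = ?c \<gamma> - ?c \<delta>" unfolding A_def by blast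
    then have "set_mset (mset \<gamma>) \<subseteq> E" "set_mset (mset \<delta>) \<subseteq> E"
      using walk_edges by (auto simp: compensated_loops_def)
    then show "a \<in> B" using M(3) total_cost_in_B B by (simp add: additive_subgroup_def)
  qed
  moreover have "f \<in> A \<rightarrow> carrier H" unfolding A_def using f by auto
  moreover have "f (a + b) = f a \<otimes> f b" if abA: "a \<in> A" "b \<in> A" for a b
  proof -
    obtain \<gamma> \<delta> \<gamma>' \<delta>' where M: "\<gamma> \<in> ?M" "\<delta> \<in> ?M" "\<gamma>' \<in> ?M" "\<delta>' \<in> ?M"
      and ab: "a = ?c \<gamma> - ?c \<delta>" "b = ?c \<gamma>' - ?c \<delta>'" using abA unfolding A_def by blast
    have "a + b = ?c (\<gamma> @ \<gamma>') - ?c (\<delta>' @ \<delta>)" using ab by simp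
    then have "f (a + b) = ?v (\<gamma> @ \<gamma>') \<otimes> inv (?v (\<delta>' @ \<delta>))"
      using f[of "\<gamma> @ \<gamma>'" "\<delta>' @ \<delta>"] compensated_loops_append M by simp
    also have "\<dots> = ?v \<gamma> \<otimes> (?v \<gamma>' \<otimes> inv (?v \<delta>)) \<otimes> inv (?v \<delta>')"
      by (simp add: value_of_append inv_mult_group m_assoc)
    also have "?v \<gamma>' \<otimes> inv (?v \<delta>) = inv (?v \<delta>) \<otimes> ?v \<gamma>'" using inv_comm M by simp
    also have "?v \<gamma> \<otimes> (inv (?v \<delta>) \<otimes> ?v \<gamma>') \<otimes> inv (?v \<delta>') = f a \<otimes> f b"
      using ab f M by (simp add: m_assoc)
    finally show ?thesis .
  qed
  moreover have "loop_group (set es) p = f ` A"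
  proof
    show "loop_group (set es) p \<subseteq> f ` A"
    proof
      fix g
      assume "g \<in> loop_group (set es) p"
      then obtain \<gamma> \<delta> where M: "\<gamma> \<in> ?M" "\<delta> \<in> ?M" "g = ?v \<gamma> \<otimes> inv (?v \<delta>)"
        unfolding loop_group_def by blast
      then have "g = f (?c \<gamma> - ?c \<delta>)" using f by simp
      moreover have "?c \<gamma> - ?c \<delta> \<in> A" unfolding A_def using M by blast
      ultimately show "g \<in> f ` A" by blast
    qed
    show "f ` A \<subseteq> loop_group (set es) p"
      unfolding A_def loop_group_def using f by blast
  qed
  ultimately show ?thesis unfolding additive_image_def by blast
qed

lemma value_in_loop_group:
  assumes "\<gamma> \<in> compensated_loops F p"
  shows "value_of \<gamma> \<in> loop_group F p"
proof -
  have "value_of \<gamma> = value_of \<gamma> \<otimes> inv (value_of [])" by simp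
  then show ?thesis unfolding loop_group_def using assms Nil_in_compensated_loops by blast
qed

end

section \<open>A loop group of finite index\<close>

lemma drop_take_split:
  assumes "a \<le> b" "b \<le> c"
  shows "drop a (take c es) = drop a (take b es) @ drop b (take c es)"
proof -
  let ?L = "take c es"
  have "drop a ?L = take (b - a) (drop a ?L) @ drop (b - a) (drop a ?L)"
    by (simp only: append_take_drop_id)
  also have "drop (b - a) (drop a ?L) = drop b ?L" using assms(1) by simp
  also have "take (b - a) (drop a ?L) = drop a (take b ?L)" by (rule drop_take[symmetric])
  also have "take b ?L = take b es" using assms(2) by (simp add: min_def)
  finally show ?thesis .
qed

lemma disjoint_segments_submultiset:
  assumes "\<And>b. b < N \<Longrightarrow> c b \<le> l b \<and> l b \<le> r b \<and> r b \<le> c (Suc b)"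
  shows "(\<Sum>b<N. mset (drop (l b) (take (r b) es))) \<subseteq># mset (take (c N) es)"
  using assms
proof (induction N)
  case (Suc N)
  let ?seg = "\<lambda>i j. drop i (take j es)"
  have c: "c N \<le> l N" "l N \<le> r N" "r N \<le> c (Suc N)" using Suc.prems[of N] by auto
  have "take (c (Suc N)) es = take (c N) es @ ?seg (c N) (l N) @ ?seg (l N) (r N) @ ?seg (r N) (c (Suc N))"
    using drop_take_split[of 0 "c N" "c (Suc N)" es] drop_take_split[of "c N" "l N" "c (Suc N)" es]
      drop_take_split[of "l N" "r N" "c (Suc N)" es] c by simp
  from arg_cong[OF this, of mset] have "mset (take (c (Suc N)) es) =
      (mset (take (c N) es) + mset (?seg (l N) (r N))) +
      (mset (?seg (c N) (l N)) + mset (?seg (r N) (c (Suc N))))"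
    by (simp only: mset_append ac_simps)
  then have "mset (take (c N) es) + mset (?seg (l N) (r N)) \<subseteq># mset (take (c (Suc N)) es)"
    by (simp only: mset_subset_eq_add_left)
  moreover have "(\<Sum>b<N. mset (?seg (l b) (r b))) \<subseteq># mset (take (c N) es)"
    using Suc by simp
  then have "(\<Sum>b<N. mset (?seg (l b) (r b))) + mset (?seg (l N) (r N)) \<subseteq>#
      mset (take (c N) es) + mset (?seg (l N) (r N))"
    by (rule subset_mset.add_right_mono)
  ultimately show ?case
    unfolding sum.lessThan_Suc by (rule subset_mset.order_trans[rotated])
qed simp

text \<open>The assumption \<open>tracking\<close> is the other half of the word problem condition: every sequence of
  group elements is passed, up to a bounded error \<open>d\<close>, by the prefixes of some accepting walk. The
  error arises because an edge may read several letters at once.\<close>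

locale tracking_automaton = abelian_automaton H E src tgt cost val init T B
  for H :: "('h, 'c) monoid_scheme" (structure)
    and E :: "'e set" and src tgt :: "'e \<Rightarrow> 'q"
    and cost :: "'e \<Rightarrow> 'a::ab_group_add" and val :: "'e \<Rightarrow> 'h"
    and init :: 'q and T :: "'q set" and B :: "'a set" +
  fixes D :: "'h set"
  assumes finite_D: "finite D" and D_closed: "D \<subseteq> carrier H"
    and tracking: "(\<And>i::nat. x i \<in> carrier H) \<Longrightarrow>
      \<exists>es k. accepting es \<and> (\<forall>j\<le>N. \<forall>i\<le>j. k i \<le> k j) \<and>
        (\<forall>i\<le>N. \<exists>d\<in>D. value_of (take (k i) es) = x i \<otimes> d)"
begin

definition loop_groups :: "'h set set" where
  "loop_groups = {loop_group (set es) p | es p. accepting es \<and> p \<in> visited (set es)}"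

text \<open>Stray loops are far from being compensated: their values avoid the loop groups of all accepting
  walks, not just of \<open>es\<close>, so that different walks can be compared. The summands of \<open>mset es\<close> make the
  loops disjoint.\<close>

definition has_stray_loops :: "nat \<Rightarrow> 'e list \<Rightarrow> bool" where
  "has_stray_loops N es \<longleftrightarrow> (\<exists>W \<gamma>. mset es = W + (\<Sum>b<N. mset (\<gamma> b)) \<and>
    (\<forall>b<N. \<exists>p\<in>visited (set es). walk p (\<gamma> b) p \<and> (\<forall>K\<in>loop_groups. value_of (\<gamma> b) \<notin> K)))"

lemma finite_visited: "finite (visited E)"
  using finite_edges by (simp add: visited_def)

lemma accepting_edges: "accepting es \<Longrightarrow> set es \<subseteq> E"
  unfolding accepting_def using walk_edges by blast

lemma visited_mono: "F \<subseteq> F' \<Longrightarrow> visited F \<subseteq> visited F'"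
  by (auto simp: visited_def)

lemma finite_loop_groups: "finite loop_groups"
proof (rule finite_subset)
  show "loop_groups \<subseteq> (\<lambda>(F, p). loop_group F p) ` (Pow E \<times> visited E)"
  proof
    fix K
    assume "K \<in> loop_groups"
    then obtain es p where es: "K = loop_group (set es) p" "accepting es" "p \<in> visited (set es)"
      unfolding loop_groups_def by blast
    have "(set es, p) \<in> Pow E \<times> visited E"
      using es(3) accepting_edges[OF es(2)] visited_mono by blast
    then show "K \<in> (\<lambda>(F, p). loop_group F p) ` (Pow E \<times> visited E)"
      unfolding es(1) by (intro image_eqI[of _ _ "(set es, p)"]) simp_all
  qed
  show "finite ((\<lambda>(F, p). loop_group F p) ` (Pow E \<times> visited E))"
    using finite_edges finite_visited by simp
qed

lemma loop_groups_additive_image: "K \<in> loop_groups \<Longrightarrow> additive_image H B K"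
  unfolding loop_groups_def using loop_group_additive_image by blast

text \<open>Let the walk follow a sequence \<open>x\<close> whose quotients \<open>inv (x i) \<otimes> x j\<close> avoid all conjugates of loop
  groups by elements of \<open>D\<close>. Among sufficiently many consecutive indices two have the same state
  and the same error, so a loop closes between them, and its value is a conjugate of such a
  quotient. Consecutive blocks of indices give disjoint loops.\<close>

lemma accepting_with_many_stray_loops:
  fixes N :: nat
  assumes infinite_index: "\<And>K. additive_image H B K \<Longrightarrow> infinite (rcosets K)"
  shows "\<exists>es. accepting es \<and> has_stray_loops N es"
proof -
  define conj where "conj d K = (\<lambda>k. d \<otimes> k \<otimes> inv d) ` K" for d K
  \<comment> \<open>Conjugation by \<open>d\<close> undoes the tracking error at the two ends of a loop.\<close>
  define \<K> where "\<K> = (\<lambda>(d, K). conj d K) ` (D \<times> loop_groups)"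
  have fin: "finite \<K>" unfolding \<K>_def using finite_D finite_loop_groups by simp
  have img: "additive_image H B K" if K: "K \<in> \<K>" for K
  proof -
    obtain d L where "d \<in> D" "L \<in> loop_groups" "K = conj d L" using K unfolding \<K>_def by auto
    then show ?thesis
      using additive_image_conjugate[OF loop_groups_additive_image] D_closed
      unfolding conj_def by blast
  qed
  \<comment> \<open>One index more than there are pairs of a state and an error, so that each block of \<open>m\<close>
     indices contains a repetition.\<close>
  define m where "m = Suc (card (visited E \<times> D))"
  obtain x where x: "\<forall>i::nat. x i \<in> carrier H"
      "\<forall>j\<le>N * m. \<forall>i<j. \<forall>K\<in>\<K>. inv (x i) \<otimes> x j \<notin> K"
    using sequence_avoiding_subgroups[OF fin, of "N * m"] additive_image_subgroup[OF img]
      infinite_index[OF img] by blast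
  obtain es k where es: "accepting es" and k_mono: "\<forall>j\<le>N * m. \<forall>i\<le>j. k i \<le> k j"
    and k_track: "\<forall>i\<le>N * m. \<exists>d\<in>D. value_of (take (k i) es) = x i \<otimes> d"
    using tracking[of x "N * m"] x(1) by blast
  obtain d where d: "\<forall>i\<le>N * m. d i \<in> D \<and> value_of (take (k i) es) = x i \<otimes> d i"
    using k_track by metis
  obtain t where t: "walk init es t" using es by (auto simp: accepting_def)
  have "\<exists>q. walk init (take (k i) es) q" for i
    using t walk_append[of init "take (k i) es" "drop (k i) es" t] by auto
  then obtain q where q: "\<And>i. walk init (take (k i) es) (q i)" by metis
  have q_visited: "q i \<in> visited (set es)" for i
    using walk_end_visited[OF q[of i]] set_take_subset[of "k i" es] by (auto simp: visited_def)
  have block: "\<exists>i j. b * m \<le> i \<and> i < j \<and> j < Suc b * m \<and> q i = q j \<and> d i = d j" if b: "b < N" for b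
  proof -
    let ?I = "{b * m..<Suc b * m}"
    have "Suc b * m \<le> N * m" using b by (intro mult_le_mono1) simp
    then have "(\<lambda>i. (q i, d i)) ` ?I \<subseteq> visited E \<times> D"
      using q_visited visited_mono[OF accepting_edges[OF es]] d by fastforce
    then have "card ((\<lambda>i. (q i, d i)) ` ?I) \<le> card (visited E \<times> D)"
      using finite_visited finite_D by (intro card_mono) simp_all
    also have "\<dots> < card ?I" by (simp add: m_def)
    finally have "\<not> inj_on (\<lambda>i. (q i, d i)) ?I" by (rule pigeonhole)
    then obtain i j where ij: "i \<in> ?I" "j \<in> ?I" "i \<noteq> j" "q i = q j \<and> d i = d j"
      unfolding inj_on_def by blast
    show ?thesis
    proof (cases "i < j")
      case True
      then show ?thesis using ij by (intro exI[of _ i] exI[of _ j]) simp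
    next
      case False
      then show ?thesis using ij by (intro exI[of _ j] exI[of _ i]) simp
    qed
  qed
  then obtain i j where ij: "\<forall>b<N. b * m \<le> i b \<and> i b < j b \<and> j b < Suc b * m \<and> q (i b) = q (j b) \<and> d (i b) = d (j b)"
    by metis
  have bound: "Suc b * m \<le> N * m" if "b < N" for b using that by (intro mult_le_mono1) simp
  let ?\<gamma> = "\<lambda>b. drop (k (i b)) (take (k (j b)) es)"
  have "(\<Sum>b<N. mset (?\<gamma> b)) \<subseteq># mset (take (k (N * m)) es)"
  proof (rule disjoint_segments_submultiset[where c = "\<lambda>b. k (b * m)"])
    fix b
    assume b: "b < N"
    have "b * m \<le> i b" "i b \<le> j b" "j b \<le> Suc b * m" "Suc b * m \<le> N * m"
      using ij b bound[OF b] by auto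
    then show "k (b * m) \<le> k (i b) \<and> k (i b) \<le> k (j b) \<and> k (j b) \<le> k (Suc b * m)"
      using k_mono by (meson le_trans)
  qed
  also have "\<dots> \<subseteq># mset es"
    by (metis append_take_drop_id mset_append mset_subset_eq_add_left)
  finally obtain W where W: "mset es = W + (\<Sum>b<N. mset (?\<gamma> b))"
    by (metis add.commute mset_subset_eq_exists_conv)
  have "\<exists>p\<in>visited (set es). walk p (?\<gamma> b) p \<and> (\<forall>K\<in>loop_groups. value_of (?\<gamma> b) \<notin> K)"
    if b: "b < N" for b
  proof -
    let ?i = "i b" and ?j = "j b"
    have o: "?i < ?j" "?j \<le> N * m" "q ?i = q ?j" "d ?i = d ?j" using ij b bound[OF b] by auto
    have kk: "k ?i \<le> k ?j" using k_mono o by simp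
    have wj: "walk init (take (k ?j) es) (q ?i)" using q[of ?j] o(3) by simp
    note seg = walk_segment[OF q[of ?i] wj kk]
    have di: "d ?i \<in> D" "value_of (take (k ?i) es) = x ?i \<otimes> d ?i"
      and dj: "value_of (take (k ?j) es) = x ?j \<otimes> d ?i" using d o by auto
    have dc: "d ?i \<in> carrier H" using di D_closed by blast
    let ?v = "value_of (?\<gamma> b)"
    have xc: "x ?i \<in> carrier H" "x ?j \<in> carrier H" using x(1) by auto
    have "x ?j \<otimes> d ?i = x ?i \<otimes> d ?i \<otimes> ?v"
      using arg_cong[OF seg(2), of value_of] di(2) dj by (simp add: value_of_append)
    then have "x ?j = x ?i \<otimes> d ?i \<otimes> ?v \<otimes> inv (d ?i)"
      using xc dc by (simp add: inv_solve_right)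
    then have x_eq: "inv (x ?i) \<otimes> x ?j = d ?i \<otimes> ?v \<otimes> inv (d ?i)"
      using xc dc by (simp add: m_assoc inv_solve_left')
    have "?v \<notin> K" if K: "K \<in> loop_groups" for K
    proof
      assume "?v \<in> K"
      then have "inv (x ?i) \<otimes> x ?j \<in> conj (d ?i) K" unfolding x_eq conj_def by blast
      moreover have "conj (d ?i) K \<in> \<K>" unfolding \<K>_def using di(1) K by auto
      ultimately show False using x(2) o(1,2) by blast
    qed
    then show ?thesis using seg(1) q_visited by blast
  qed
  then have "has_stray_loops N es"
    unfolding has_stray_loops_def using W by (intro exI[of _ W] exI[of _ ?\<gamma>]) simp
  then show ?thesis using es by blast
qed

text \<open>If every such image, in particular every conjugate of a loop group, had infinite index, there
  would be accepting walks \<open>es N\<close> with \<open>N\<close> stray loops for each \<open>N\<close>. After fixing the edge set and the terminal state, Dickson's lemma finds a walk \<open>a\<close>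
  contained, as a multiset, in some \<open>es N\<close> with more stray loops than \<open>a\<close> has edges. Then \<open>a\<close> can be
  taken out of \<open>es N\<close> without touching one of the loops; the rest of \<open>es N\<close> is a circulation which
  cancels the cost of this loop, because both walks have cost \<open>0\<close>. So the loop is compensated and
  not stray.\<close>

theorem additive_image_of_finite_index: "\<exists>K. additive_image H B K \<and> finite (rcosets K)"
proof (rule ccontr)
  assume "\<not> ?thesis"
  then have inf: "\<And>K. additive_image H B K \<Longrightarrow> infinite (rcosets K)" by blast
  have "\<forall>N. \<exists>es. accepting es \<and> has_stray_loops N es"
    using accepting_with_many_stray_loops[OF inf] by simp
  then obtain es where "\<forall>N. accepting (es N) \<and> has_stray_loops N (es N)" by metis
  then have es: "accepting (es N)" and stray: "has_stray_loops N (es N)" for N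
    by simp_all
  have "\<forall>N. \<exists>t. t \<in> T \<and> walk init (es N) t"
    using es unfolding accepting_def by blast
  then obtain t where t: "\<And>N. t N \<in> T \<and> walk init (es N) (t N)" by metis
  have cost0: "total_cost (mset (es N)) = 0" for N using es unfolding accepting_def by blast
  \<comment> \<open>Equal edge sets put the difference of two walks inside the support of the smaller one, and
     equal terminal states make the difference balanced.\<close>
  have "(\<lambda>N. (set (es N), t N)) ` UNIV \<subseteq> Pow E \<times> T"
    using accepting_edges[OF es] t by auto
  then have "finite ((\<lambda>N. (set (es N), t N)) ` UNIV)"
    using finite_edges finite_terminals by (simp add: finite_subset)
  then obtain M where "infinite {N \<in> UNIV. (set (es N), t N) = (set (es M), t M)}"
    using pigeonhole_infinite[OF infinite_UNIV_nat, of "\<lambda>N. (set (es N), t N)"] by blast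
  then have M: "infinite {N. (set (es N), t N) = (set (es M), t M)}" by simp
  define F s where "F = set (es M)" and "s = t M"
  define \<psi> where "\<psi> = enumerate {N. (set (es N), t N) = (F, s)}"
  have "strict_mono \<psi>"
    using strict_mono_enumerate[OF M] by (simp only: \<psi>_def F_def s_def)
  moreover have "\<psi> i \<in> {N. (set (es N), t N) = (F, s)}" for i
    using enumerate_in_set[OF M] by (simp only: \<psi>_def F_def s_def)
  ultimately have \<psi>: "strict_mono \<psi>" "\<And>i. set (es (\<psi> i)) = F" "\<And>i. t (\<psi> i) = s"
    by simp_all
  have "set_mset (mset (es (\<psi> i))) \<subseteq> E" for i using accepting_edges[OF es] by simp
  from dickson_multiset_sequence[OF finite_edges, of "\<lambda>i. mset (es (\<psi> i))", OF this]
  obtain \<phi> :: "nat \<Rightarrow> nat" where \<phi>: "strict_mono \<phi>"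
      "\<forall>i j. i \<le> j \<longrightarrow> mset (es (\<psi> (\<phi> i))) \<subseteq># mset (es (\<psi> (\<phi> j)))" by blast
  define a where "a = es (\<psi> (\<phi> 0))"
  \<comment> \<open>The index is pushed beyond \<open>length a\<close> so that \<open>es N\<close> has a loop to spare.\<close>
  define N where "N = \<psi> (\<phi> (Suc (length a)))"
  have len: "length a < N"
    using strict_mono_imp_increasing[OF \<psi>(1), of "\<phi> (Suc (length a))"]
      strict_mono_imp_increasing[OF \<phi>(1), of "Suc (length a)"] unfolding N_def by simp
  obtain W \<gamma> where W: "mset (es N) = W + (\<Sum>b<N. mset (\<gamma> b))"
    and \<gamma>: "\<forall>b<N. \<exists>p\<in>visited (set (es N)). walk p (\<gamma> b) p \<and> (\<forall>K\<in>loop_groups. value_of (\<gamma> b) \<notin> K)"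
    using stray[of N] unfolding has_stray_loops_def by blast
  have "mset a \<subseteq># mset (es N)" using \<phi>(2) unfolding a_def N_def by blast
  then have "mset a \<subseteq># W + (\<Sum>b<N. mset (\<gamma> b))" unfolding W .
  then obtain b where b: "b < N" "mset a + mset (\<gamma> b) \<subseteq># mset (es N)"
    using submultiset_sum_avoids_summand[of "mset a" W "\<lambda>b. mset (\<gamma> b)" N] len W by auto
  obtain p where p: "p \<in> visited (set (es N))" "walk p (\<gamma> b) p" "\<forall>K\<in>loop_groups. value_of (\<gamma> b) \<notin> K"
    using \<gamma> b(1) by blast
  obtain Z where Z: "mset (es N) = mset a + mset (\<gamma> b) + Z"
    using b(2) by (metis mset_subset_eq_exists_conv)
  have support: "set (es N) = F" "set a = F" using \<psi>(2) by (simp_all add: N_def a_def)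
  have walks: "walk init (es N) s" "walk init a s"
    using t[of N] t[of "\<psi> (\<phi> 0)"] \<psi>(3) by (simp_all add: N_def a_def)
  have "(image_mset tgt (mset a) + {#init#} + image_mset tgt (mset (\<gamma> b))) + image_mset src Z =
      (image_mset tgt (mset a) + {#init#} + image_mset tgt (mset (\<gamma> b))) + image_mset tgt Z"
  proof -
    have "image_mset src (mset (\<gamma> b)) = image_mset tgt (mset (\<gamma> b))"
      using walk_balance[OF p(2)] by simp
    then have "(image_mset tgt (mset a) + {#init#} + image_mset tgt (mset (\<gamma> b))) + image_mset src Z =
        image_mset src (mset (es N)) + {#s#}"
      unfolding walk_balance[OF walks(2), symmetric] Z by simp
    also have "\<dots> = image_mset tgt (mset (es N)) + {#init#}" by (rule walk_balance[OF walks(1)])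
    finally show ?thesis unfolding Z by simp
  qed
  then have "balanced Z" unfolding balanced_def by (simp only: add_left_cancel)
  moreover have "set_mset Z \<subseteq> F" "set (\<gamma> b) \<subseteq> F"
    using arg_cong[OF Z, of set_mset] support by auto
  moreover have "total_cost (mset (\<gamma> b)) + total_cost Z = 0"
    using arg_cong[OF Z, of total_cost] cost0[of N] cost0[of "\<psi> (\<phi> 0)"] by (simp add: a_def)
  ultimately have "\<gamma> b \<in> compensated_loops (set a) p"
    using p(2) support(2) unfolding compensated_loops_def by blast
  then have "value_of (\<gamma> b) \<in> loop_group (set a) p" by (rule value_in_loop_group)
  moreover have "accepting a" unfolding a_def by (rule es)
  moreover have "p \<in> visited (set a)" using p(1) support by simp
  ultimately show False using p(3) unfolding loop_groups_def by blast
qed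

end

section \<open>Finite-index images of subgroups of the integer lattice\<close>

definition int_lattice :: "nat set \<Rightarrow> (nat \<Rightarrow> int) set" where
  "int_lattice I = {z. \<forall>i. i \<notin> I \<longrightarrow> z i = 0}"

lemma additive_subgroup_int_lattice: "additive_subgroup (int_lattice I)"
  by (simp add: additive_subgroup_def int_lattice_def)

lemma additive_subgroup_minus:
  assumes "additive_subgroup A" "a \<in> A"
  shows "- a \<in> A"
proof -
  have "0 - a \<in> A" using assms unfolding additive_subgroup_def by blast
  then show ?thesis by simp
qed

lemma additive_subgroup_scale:
  fixes A :: "(nat \<Rightarrow> int) set"
  assumes A: "additive_subgroup A" and a: "a \<in> A"
  shows "(\<lambda>j. k * a j) \<in> A"
proof -
  have nat: "(\<lambda>j. int n * a j) \<in> A" for n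
  proof (induction n)
    case 0
    have "(\<lambda>j. int 0 * a j) = 0" by (simp add: fun_eq_iff)
    then show ?case using A by (simp add: additive_subgroup_def)
  next
    case (Suc n)
    have "(\<lambda>j. int (Suc n) * a j) = (\<lambda>j. int n * a j) + a"
      by (simp add: fun_eq_iff algebra_simps)
    then show ?case using additive_subgroup_add[OF A Suc a] by simp
  qed
  show ?thesis
  proof (cases "0 \<le> k")
    case True
    then show ?thesis using nat[of "nat k"] by simp
  next
    case False
    then have "(\<lambda>j. k * a j) = - (\<lambda>j. int (nat (- k)) * a j)" by (simp add: fun_eq_iff)
    then show ?thesis using additive_subgroup_minus[OF A nat[of "nat (- k)"]] by simp
  qed
qed

lemma additive_subgroup_combination:
  fixes A :: "(nat \<Rightarrow> int) set" and n :: nat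
  assumes A: "additive_subgroup A" and b: "\<forall>i<n. b i \<in> A"
  shows "(\<lambda>j. \<Sum>i<n. z i * b i j) \<in> A"
  using b
proof (induction n)
  case 0
  have "(\<lambda>j::nat. \<Sum>i<0. z i * b i j) = 0" by (simp add: fun_eq_iff)
  then show ?case using A by (simp add: additive_subgroup_def)
next
  case (Suc n)
  have "(\<lambda>j. \<Sum>i<Suc n. z i * b i j) = (\<lambda>j. \<Sum>i<n. z i * b i j) + (\<lambda>j. z n * b n j)"
    by (simp add: fun_eq_iff)
  then show ?case
    using additive_subgroup_add[OF A Suc.IH additive_subgroup_scale[OF A]] Suc.prems by simp
qed

text \<open>The values of one coordinate on \<open>A\<close> form a subgroup of the integers, which is cyclic.\<close>

lemma coordinate_generator:
  fixes A :: "(nat \<Rightarrow> int) set"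
  assumes A: "additive_subgroup A"
  shows "\<exists>g\<in>A. \<forall>a\<in>A. \<exists>q. a n = q * g n"
proof (cases "\<forall>a\<in>A. a n = 0")
  case True
  then show ?thesis using A by (intro bexI[of _ 0]) (auto simp: additive_subgroup_def)
next
  case False
  then obtain a0 where a0: "a0 \<in> A" "a0 n \<noteq> 0" by blast
  define P where "P k \<longleftrightarrow> k > 0 \<and> (\<exists>a\<in>A. a n = int k)" for k
  have "P (nat \<bar>a0 n\<bar>)"
  proof (cases "a0 n > 0")
    case True
    then show ?thesis using a0 unfolding P_def by (intro conjI bexI[of _ a0]) auto
  next
    case False
    then show ?thesis using a0 additive_subgroup_minus[OF A a0(1)] unfolding P_def
      by (intro conjI bexI[of _ "- a0"]) auto
  qed
  then have "P (LEAST k. P k)" by (rule LeastI)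
  then obtain g where g: "g \<in> A" "g n = int (LEAST k. P k)" "g n > 0" unfolding P_def by auto
  have "\<exists>q. a n = q * g n" if a: "a \<in> A" for a
  proof -
    define r where "r = a - (\<lambda>j. (a n div g n) * g j)"
    have rA: "r \<in> A" using A a additive_subgroup_scale[OF A g(1)]
      unfolding r_def additive_subgroup_def by blast
    have rn: "r n = a n mod g n" by (simp add: r_def minus_div_mult_eq_mod)
    have "\<not> P (nat (r n))"
    proof
      assume "P (nat (r n))"
      then have "(LEAST k. P k) \<le> nat (r n)" by (rule Least_le)
      then show False using g(2,3) rn pos_mod_bound[of "g n" "a n"] by linarith
    qed
    then have "\<not> 0 < r n" using rA unfolding P_def by auto
    then have "r n = 0" using g(3) rn pos_mod_sign[of "g n" "a n"] by linarith
    then have "a n = (a n div g n) * g n" using rn by (simp add: mult_div_mod_eq minus_div_mult_eq_mod[symmetric])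
    then show ?thesis by blast
  qed
  then show ?thesis using g(1) by blast
qed

text \<open>One generator takes care of the last coordinate, the induction hypothesis of the vectors of the
  subgroup on which this coordinate vanishes.\<close>

lemma int_lattice_subgroup_generators:
  assumes "additive_subgroup A" "A \<subseteq> int_lattice {..<n}"
  shows "\<exists>b. (\<forall>i<n. b i \<in> A) \<and> (\<forall>a\<in>A. \<exists>z. a = (\<lambda>j. \<Sum>i<n. z i * b i j))"
  using assms
proof (induction n arbitrary: A)
  case 0
  then have "a = (\<lambda>j. \<Sum>i<0. z i * b i j)" if "a \<in> A" for a b and z :: "nat \<Rightarrow> int"
    using that by (auto simp: int_lattice_def fun_eq_iff)
  then show ?case by blast
next
  case (Suc n)
  let ?A = "{a \<in> A. a n = 0}"
  have sub: "additive_subgroup ?A" using Suc.prems(1) by (simp add: additive_subgroup_def)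
  have "?A \<subseteq> int_lattice {..<n}"
  proof
    fix a
    assume a: "a \<in> ?A"
    have "a i = 0" if "\<not> i < n" for i
      using a that Suc.prems(2) by (cases "i = n") (auto simp: int_lattice_def)
    then show "a \<in> int_lattice {..<n}" by (simp add: int_lattice_def)
  qed
  then obtain b where b: "\<forall>i<n. b i \<in> ?A" "\<forall>a\<in>?A. \<exists>z. a = (\<lambda>j. \<Sum>i<n. z i * b i j)"
    using Suc.IH[OF sub] by blast
  obtain g where g: "g \<in> A" "\<forall>a\<in>A. \<exists>q. a n = q * g n"
    using coordinate_generator[OF Suc.prems(1)] by blast
  let ?b = "b(n := g)"
  have "\<exists>z. a = (\<lambda>j. \<Sum>i<Suc n. z i * ?b i j)" if a: "a \<in> A" for a
  proof -
    obtain q where q: "a n = q * g n" using g(2) a by blast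
    have "a - (\<lambda>j. q * g j) \<in> A"
      using Suc.prems(1) a additive_subgroup_scale[OF Suc.prems(1) g(1)]
      unfolding additive_subgroup_def by blast
    then have "a - (\<lambda>j. q * g j) \<in> ?A" using q by simp
    then obtain z where z: "a - (\<lambda>j. q * g j) = (\<lambda>j. \<Sum>i<n. z i * b i j)" using b(2) by blast
    have "a j = (\<Sum>i<Suc n. (z(n := q)) i * ?b i j)" for j
    proof -
      have "a j = (\<Sum>i<n. z i * b i j) + q * g j" using fun_cong[OF z, of j] by simp
      then show ?thesis by simp
    qed
    then show ?thesis by blast
  qed
  moreover have "\<forall>i<Suc n. ?b i \<in> A" using b(1) g(1) by (simp add: less_Suc_eq)
  ultimately show ?case by blast
qed

context group
begin

lemma finite_rcosets_if_covered:
  assumes "subgroup L G" "finite Y" "Y \<subseteq> carrier G"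
    and cov: "\<And>z. z \<in> carrier G \<Longrightarrow> \<exists>y\<in>Y. z \<in> L #> y"
  shows "finite (rcosets L)"
proof (rule finite_subset)
  show "rcosets L \<subseteq> (\<lambda>y. L #> y) ` Y"
  proof
    fix C
    assume "C \<in> rcosets L"
    then obtain z where z: "z \<in> carrier G" "C = L #> z" unfolding RCOSETS_def by blast
    obtain y where y: "y \<in> Y" "z \<in> L #> y" using cov[OF z(1)] by blast
    have "L #> y = L #> z" using repr_independence[OF y(2) _ assms(1)] y(1) assms(3) by blast
    then have "C = L #> y" using z(2) by simp
    then show "C \<in> (\<lambda>y. L #> y) ` Y" using y(1) by blast
  qed
qed (simp add: assms(2))

lemma finite_rcosets_transversal:
  assumes "subgroup K G" "finite (rcosets K)"
  shows "\<exists>X. finite X \<and> X \<subseteq> carrier G \<and> (\<forall>z\<in>carrier G. \<exists>x\<in>X. z \<in> K #> x)"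
proof -
  have "rcosets K = (\<lambda>x. K #> x) ` carrier G" unfolding RCOSETS_def by blast
  then obtain X where X: "X \<subseteq> carrier G" "finite X" "rcosets K = (\<lambda>x. K #> x) ` X"
    using finite_subset_image[of "rcosets K" "\<lambda>x. K #> x" "carrier G"] assms(2) by auto
  have "\<exists>x\<in>X. z \<in> K #> x" if z: "z \<in> carrier G" for z
  proof -
    have "K #> z \<in> rcosets K" using z unfolding RCOSETS_def by blast
    then obtain x where x: "x \<in> X" "K #> z = K #> x" using X(3) by auto
    have "z \<in> K #> z" by (rule rcos_self[OF z assms(1)])
    then show ?thesis using x by auto
  qed
  then show ?thesis using X(1,2) by blast
qed

end

locale int_lattice_hom = group H
  for H :: "('h, 'c) monoid_scheme" (structure) +
  fixes F :: "(nat \<Rightarrow> int) \<Rightarrow> 'h"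
  assumes F_closed [simp]: "F z \<in> carrier H"
    and F_add: "F (y + z) = F y \<otimes> F z"
begin

lemma F_zero: "F 0 = \<one>"
proof -
  have "F 0 \<otimes> F 0 = F 0" using F_add[of 0 0] by simp
  then show ?thesis by simp
qed

lemma F_minus: "F (- z) = inv (F z)"
proof -
  have "F (- z) \<otimes> F z = \<one>" using F_add[of "- z" z] F_zero by simp
  then show ?thesis by (simp add: inv_equality)
qed

lemma F_diff: "F (y - z) = F y \<otimes> inv (F z)"
  using F_add[of y "- z"] F_minus[of z] by simp

definition independent :: "nat set \<Rightarrow> bool" where
  "independent I \<longleftrightarrow> (\<forall>z\<in>int_lattice I. F z = \<one> \<longrightarrow> z = 0)"

definition axis :: "nat \<Rightarrow> int \<Rightarrow> nat \<Rightarrow> int" where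
  "axis j m = (\<lambda>i. if i = j then m else 0)"

lemma image_int_lattice_additive_image: "additive_image H (UNIV :: (nat \<Rightarrow> int) set) (F ` int_lattice I)"
  unfolding additive_image_def
  using additive_subgroup_int_lattice[of I] F_add
  by (intro exI[of _ "int_lattice I"] exI[of _ F]) simp

text \<open>Collecting the vectors whose image lies in the subgroup \<open>F ` int_lattice I\<close> into an additive
  subgroup lets statements about powers in \<open>H\<close> be proved by calculating with vectors.\<close>

lemma additive_subgroup_preimage: "additive_subgroup {z. F z \<in> F ` int_lattice I}"
  unfolding additive_subgroup_def
proof (intro conjI ballI)
  have "0 \<in> int_lattice I" by (simp add: int_lattice_def)
  then show "0 \<in> {z. F z \<in> F ` int_lattice I}" by blast
  fix y z
  assume "y \<in> {z. F z \<in> F ` int_lattice I}" "z \<in> {z. F z \<in> F ` int_lattice I}"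
  then obtain u v where uv: "u \<in> int_lattice I" "v \<in> int_lattice I" "F y = F u" "F z = F v" by auto
  have "F (y - z) = F (u - v)" using uv F_diff by simp
  moreover have "u - v \<in> int_lattice I" using uv(1,2) by (simp add: int_lattice_def)
  ultimately show "y - z \<in> {z. F z \<in> F ` int_lattice I}" by blast
qed

text \<open>If \<open>j \<notin> I\<close>, a relation among the coordinates in \<open>insert j I\<close> must involve \<open>j\<close>, since those in \<open>I\<close> are
  independent; solving it for \<open>j\<close> expresses a nonzero multiple of the \<open>j\<close>-th generator through \<open>I\<close>.\<close>

lemma dependent_coordinate_multiple:
  assumes I: "independent I" and j: "j \<in> I \<or> \<not> independent (insert j I)"
  shows "\<exists>m>0. F (axis j m) \<in> F ` int_lattice I"
proof (cases "j \<in> I")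
  case True
  then have "axis j 1 \<in> int_lattice I" by (simp add: axis_def int_lattice_def)
  then show ?thesis by (intro exI[of _ 1]) simp
next
  case False
  then obtain z where z: "z \<in> int_lattice (insert j I)" "F z = \<one>" "z \<noteq> 0"
    using j unfolding independent_def by blast
  have u: "axis j (z j) = z - z(j := 0)" by (auto simp: axis_def fun_eq_iff)
  have zI: "z(j := 0) \<in> int_lattice I" using z(1) by (auto simp: int_lattice_def)
  have zj: "z j \<noteq> 0"
  proof
    assume "z j = 0"
    then have "z \<in> int_lattice I" using zI by (metis fun_upd_triv)
    then show False using I z(2,3) unfolding independent_def by blast
  qed
  have "F (axis j (z j)) = F (- (z(j := 0)))" unfolding u using F_diff F_minus z(2) by simp
  moreover have "- (z(j := 0)) \<in> int_lattice I" using zI by (simp add: int_lattice_def)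
  ultimately have in1: "F (axis j (z j)) \<in> F ` int_lattice I" by blast
  then have "- axis j (z j) \<in> {z. F z \<in> F ` int_lattice I}"
    using additive_subgroup_minus[OF additive_subgroup_preimage] by blast
  moreover have "- axis j (z j) = axis j (- z j)" by (simp add: axis_def fun_eq_iff)
  ultimately have in2: "F (axis j (- z j)) \<in> F ` int_lattice I" by simp
  show ?thesis
  proof (cases "z j > 0")
    case True
    then show ?thesis using in1 by blast
  next
    case False
    then show ?thesis using in2 zj by (intro exI[of _ "- z j"]) auto
  qed
qed

lemma multiple_in_image:
  assumes "\<And>j. j < n \<Longrightarrow> axis j m \<in> R" "additive_subgroup R" "z \<in> int_lattice {..<n}"
  shows "(\<lambda>i. m * z i) \<in> R"
  using assms(1,3)
proof (induction n arbitrary: z)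
  case 0
  then have "(\<lambda>i. m * z i) = 0" by (simp add: int_lattice_def fun_eq_iff)
  then show ?case using assms(2) by (simp add: additive_subgroup_def)
next
  case (Suc n)
  have "z(n := 0) \<in> int_lattice {..<n}" using Suc.prems(2) by (auto simp: int_lattice_def)
  then have "(\<lambda>i. m * (z(n := 0)) i) \<in> R"
    using Suc.IH[of "z(n := 0)"] Suc.prems(1) less_SucI by blast
  moreover have "(\<lambda>i. z n * axis n m i) \<in> R"
    using additive_subgroup_scale[OF assms(2)] Suc.prems(1) by simp
  ultimately have "(\<lambda>i. m * (z(n := 0)) i) + (\<lambda>i. z n * axis n m i) \<in> R"
    by (rule additive_subgroup_add[OF assms(2)])
  moreover have "(\<lambda>i. m * z i) = (\<lambda>i. m * (z(n := 0)) i) + (\<lambda>i. z n * axis n m i)"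
    by (auto simp: axis_def fun_eq_iff)
  ultimately show ?case by (simp only:)
qed

lemma independent_int_lattice_iso:
  assumes I: "independent I" "finite I"
  shows "H\<lparr>carrier := F ` int_lattice I\<rparr> \<cong> Z_power (card I)"
proof -
  let ?L = "F ` int_lattice I" and ?k = "card I"
  obtain e where e: "bij_betw e I {..<?k}"
    using I(2) ex_bij_betw_finite_nat[of I] atLeast0LessThan by metis
  define ext where "ext w = (\<lambda>i. if i \<in> I then w (e i) else 0)" for w :: "nat \<Rightarrow> int"
  have ext_int_lattice: "ext w \<in> int_lattice I" for w by (simp add: ext_def int_lattice_def)
  have e_less: "e i < ?k" if "i \<in> I" for i using e that bij_betwE by blast
  have Z: "group (Z_power ?k)" unfolding Z_power_def by simp
  have carrier: "carrier (Z_power ?k) = (\<Pi>\<^sub>E i\<in>{..<?k}. UNIV)"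
    by (simp add: Z_power_def)
  have "(\<lambda>w. F (ext w)) \<in> iso (Z_power ?k) (H\<lparr>carrier := ?L\<rparr>)"
    unfolding iso_def
  proof (intro CollectI conjI)
    show "(\<lambda>w. F (ext w)) \<in> hom (Z_power ?k) (H\<lparr>carrier := ?L\<rparr>)"
    proof (rule homI)
      fix w w'
      show "F (ext w) \<in> carrier (H\<lparr>carrier := ?L\<rparr>)" using ext_int_lattice by simp
      have "ext (w \<otimes>\<^bsub>Z_power ?k\<^esub> w') = ext w + ext w'"
        using e_less by (auto simp: ext_def fun_eq_iff Z_power_def)
      then show "F (ext (w \<otimes>\<^bsub>Z_power ?k\<^esub> w')) =
          F (ext w) \<otimes>\<^bsub>H\<lparr>carrier := ?L\<rparr>\<^esub> F (ext w')" by (simp add: F_add)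
    qed
    show "bij_betw (\<lambda>w. F (ext w)) (carrier (Z_power ?k)) (carrier (H\<lparr>carrier := ?L\<rparr>))"
      unfolding bij_betw_def
    proof
      show "inj_on (\<lambda>w. F (ext w)) (carrier (Z_power ?k))"
      proof (rule inj_onI)
        fix w w'
        assume w: "w \<in> carrier (Z_power ?k)" "w' \<in> carrier (Z_power ?k)" and eq: "F (ext w) = F (ext w')"
        have "F (ext w - ext w') = \<one>" using eq by (simp add: F_diff)
        moreover have "ext w - ext w' \<in> int_lattice I"
          using additive_subgroup_int_lattice ext_int_lattice unfolding additive_subgroup_def by blast
        ultimately have "ext w - ext w' = 0" using I(1) unfolding independent_def by blast
        then have ext_eq: "ext w i = ext w' i" for i using fun_cong[of "ext w - ext w'" 0 i] by simp
        show "w = w'"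
        proof (rule PiE_ext)
          show "w \<in> (\<Pi>\<^sub>E i\<in>{..<?k}. UNIV)" "w' \<in> (\<Pi>\<^sub>E i\<in>{..<?k}. UNIV)" using w carrier by auto
          fix x
          assume "x \<in> {..<?k}"
          then obtain i where "i \<in> I" "x = e i" using e unfolding bij_betw_def by blast
          then show "w x = w' x" using ext_eq[of i] by (simp add: ext_def)
        qed
      qed
      show "(\<lambda>w. F (ext w)) ` carrier (Z_power ?k) = carrier (H\<lparr>carrier := ?L\<rparr>)"
      proof
        show "(\<lambda>w. F (ext w)) ` carrier (Z_power ?k) \<subseteq> carrier (H\<lparr>carrier := ?L\<rparr>)"
          using ext_int_lattice by auto
        show "carrier (H\<lparr>carrier := ?L\<rparr>) \<subseteq> (\<lambda>w. F (ext w)) ` carrier (Z_power ?k)"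
        proof
          fix g
          assume "g \<in> carrier (H\<lparr>carrier := ?L\<rparr>)"
          then obtain z where z: "z \<in> int_lattice I" "g = F z" by auto
          let ?w = "\<lambda>x\<in>{..<?k}. z (inv_into I e x)"
          have "ext ?w = z"
          proof
            fix i
            show "ext ?w i = z i"
              using z(1) e_less[of i] bij_betw_inv_into_left[OF e, of i] by (simp add: ext_def int_lattice_def)
          qed
          moreover have "?w \<in> carrier (Z_power ?k)" unfolding carrier by simp
          ultimately show "g \<in> (\<lambda>w. F (ext w)) ` carrier (Z_power ?k)"
            unfolding z(2) by (metis (no_types, lifting) image_eqI)
        qed
      qed
    qed
  qed
  then have "Z_power ?k \<cong> H\<lparr>carrier := ?L\<rparr>" by (rule is_isoI)
  then show ?thesis by (rule group.iso_sym[OF Z])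
qed

text \<open>Take a maximal set \<open>I\<close> of coordinates on which \<open>F\<close> is injective. By maximality some common multiple
  \<open>m\<close> of every coordinate is mapped into \<open>F ` int_lattice I\<close>, so the vectors with entries in
  \<open>{0..<m}\<close> represent all its cosets in the image of \<open>F\<close>. The subgroup \<open>F ` int_lattice I\<close> is free
  abelian of rank \<open>card I \<le> n\<close>.\<close>

lemma finite_index_image_virtually_free_abelian:
  assumes fin: "finite (rcosets (F ` int_lattice {..<n}))"
  shows "virtually_free_abelian_le H n"
proof -
  let ?P = "\<lambda>I. I \<subseteq> {..<n} \<and> independent I"
  have "?P {}" by (auto simp: independent_def int_lattice_def fun_eq_iff)
  moreover have "\<forall>I. ?P I \<longrightarrow> card I < Suc n"
    using card_mono[of "{..<n}"] by (auto simp: less_Suc_eq_le)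
  ultimately obtain I where I: "?P I" and max: "\<forall>J. ?P J \<longrightarrow> card J \<le> card I"
    using ex_has_greatest_nat[of ?P "{}" card "Suc n"] by blast
  have finI: "finite I" using I finite_subset by auto
  let ?L = "F ` int_lattice I"
  have L: "subgroup ?L H" by (rule additive_image_subgroup[OF image_int_lattice_additive_image])
  have "\<exists>m>0. F (axis j m) \<in> ?L" if j: "j < n" for j
  proof (rule dependent_coordinate_multiple)
    show "independent I" using I by simp
    show "j \<in> I \<or> \<not> independent (insert j I)"
    proof (rule disjCI)
      assume "\<not> \<not> independent (insert j I)"
      then have "card (insert j I) \<le> card I" using max I j by simp
      then show "j \<in> I" using finI by (cases "j \<in> I") auto
    qed
  qed
  then obtain \<mu> where \<mu>: "\<forall>j<n. \<mu> j > 0 \<and> F (axis j (\<mu> j)) \<in> ?L" by metis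
  define m where "m = (\<Prod>j<n. \<mu> j)"
  have m: "m > 0" unfolding m_def using \<mu> by (intro prod_pos) auto
  let ?R = "{z. F z \<in> ?L}"
  have R: "additive_subgroup ?R" by (rule additive_subgroup_preimage)
  have axis_m: "axis j m \<in> ?R" if j: "j < n" for j
  proof -
    have "\<mu> j dvd m" unfolding m_def using j by (intro dvd_prodI) auto
    then obtain c where c: "m = \<mu> j * c" by (rule dvdE)
    have "axis j (\<mu> j) \<in> ?R" using \<mu> j by blast
    from additive_subgroup_scale[OF R this, of c] have "(\<lambda>i. c * axis j (\<mu> j) i) \<in> ?R" .
    moreover have "(\<lambda>i. c * axis j (\<mu> j) i) = axis j m" by (auto simp: axis_def c fun_eq_iff)
    ultimately show ?thesis by simp
  qed
  define Y where "Y = {r \<in> int_lattice {..<n}. \<forall>i. 0 \<le> r i \<and> r i < m}"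
  have "Y \<subseteq> (\<lambda>w i. if i < n then w i else 0) ` (\<Pi>\<^sub>E i\<in>{..<n}. {0..<m})"
  proof
    fix r
    assume r: "r \<in> Y"
    have "r = (\<lambda>i. if i < n then restrict r {..<n} i else 0)"
      using r by (auto simp: Y_def int_lattice_def fun_eq_iff)
    moreover have "restrict r {..<n} \<in> (\<Pi>\<^sub>E i\<in>{..<n}. {0..<m})" using r by (auto simp: Y_def)
    ultimately show "r \<in> (\<lambda>w i. if i < n then w i else 0) ` (\<Pi>\<^sub>E i\<in>{..<n}. {0..<m})" by blast
  qed
  then have finY: "finite Y" by (rule finite_subset) (simp add: finite_PiE)
  have K: "subgroup (F ` int_lattice {..<n}) H"
    by (rule additive_image_subgroup[OF image_int_lattice_additive_image])
  obtain X where X: "finite X" "X \<subseteq> carrier H" "\<forall>z\<in>carrier H. \<exists>x\<in>X. z \<in> F ` int_lattice {..<n} #> x"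
    using finite_rcosets_transversal[OF K fin] by blast
  have "finite (rcosets ?L)"
  proof (rule finite_rcosets_if_covered[OF L, of "(\<lambda>(r, x). F r \<otimes> x) ` (Y \<times> X)"])
    show "finite ((\<lambda>(r, x). F r \<otimes> x) ` (Y \<times> X))" using finY X(1) by simp
    show "(\<lambda>(r, x). F r \<otimes> x) ` (Y \<times> X) \<subseteq> carrier H" using X(2) by auto
    fix g
    assume "g \<in> carrier H"
    then obtain x where x: "x \<in> X" "g \<in> F ` int_lattice {..<n} #> x" using X(3) by blast
    then obtain z where z: "z \<in> int_lattice {..<n}" "g = F z \<otimes> x" by (auto simp: r_coset_def)
    let ?q = "\<lambda>i. m * (z i div m)" and ?r = "\<lambda>i. z i mod m"
    have "(\<lambda>i. z i div m) \<in> int_lattice {..<n}" using z(1) by (simp add: int_lattice_def)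
    then have "?q \<in> ?R" using multiple_in_image[OF axis_m R] by simp
    then have qL: "F ?q \<in> ?L" by simp
    have rY: "?r \<in> Y" using z(1) m by (simp add: Y_def int_lattice_def)
    have xc: "x \<in> carrier H" using x(1) X(2) by blast
    have "z = ?q + ?r" by (simp add: fun_eq_iff)
    then have "F z = F ?q \<otimes> F ?r" using F_add by metis
    then have "g = F ?q \<otimes> (F ?r \<otimes> x)" using z(2) xc by (simp add: m_assoc)
    then have "g \<in> ?L #> (F ?r \<otimes> x)" using qL unfolding r_coset_def by blast
    then show "\<exists>y\<in>(\<lambda>(r, x). F r \<otimes> x) ` (Y \<times> X). g \<in> ?L #> y"
      using rY x(1) by (intro bexI[of _ "F ?r \<otimes> x"]) auto
  qed
  moreover have "card I \<le> n" using I card_mono[of "{..<n}" I] by simp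
  moreover have "H\<lparr>carrier := ?L\<rparr> \<cong> Z_power (card I)" using independent_int_lattice_iso I finI by blast
  ultimately show ?thesis unfolding virtually_free_abelian_le_def using L by blast
qed

end

lemma (in group) additive_image_virtually_free_abelian:
  assumes K: "additive_image G (int_lattice {..<n}) K" and fin: "finite (rcosets K)"
  shows "virtually_free_abelian_le G n"
proof -
  obtain A f where A: "additive_subgroup A" "A \<subseteq> int_lattice {..<n}" "f \<in> A \<rightarrow> carrier G"
      "\<forall>a\<in>A. \<forall>b\<in>A. f (a + b) = f a \<otimes> f b" "K = f ` A"
    using K unfolding additive_image_def by blast
  obtain b where b: "\<forall>i<n. b i \<in> A" "\<forall>a\<in>A. \<exists>z. a = (\<lambda>j. \<Sum>i<n. z i * b i j)"
    using int_lattice_subgroup_generators[OF A(1,2)] by blast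
  define c where "c z = (\<lambda>j. \<Sum>i<n. z i * b i j)" for z :: "nat \<Rightarrow> int"
  have cA: "c z \<in> A" for z unfolding c_def using additive_subgroup_combination[OF A(1)] b(1) by blast
  have c_add: "c (y + z) = c y + c z" for y z
    by (simp add: c_def fun_eq_iff algebra_simps sum.distrib)
  interpret int_lattice_hom G "\<lambda>z. f (c z)"
  proof
    show "f (c z) \<in> carrier G" for z using A(3) cA by blast
    show "f (c (y + z)) = f (c y) \<otimes> f (c z)" for y z unfolding c_add using A(4) cA by blast
  qed
  have "f ` A \<subseteq> (\<lambda>z. f (c z)) ` int_lattice {..<n}"
  proof
    fix g
    assume "g \<in> f ` A"
    then obtain a where a: "a \<in> A" "g = f a" by blast
    obtain z where z: "a = c z" using b(2) a(1) unfolding c_def by blast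
    have "c z = c (\<lambda>i. if i < n then z i else 0)" by (simp add: c_def)
    moreover have "(\<lambda>i. if i < n then z i else 0) \<in> int_lattice {..<n}" by (simp add: int_lattice_def)
    ultimately show "g \<in> (\<lambda>z. f (c z)) ` int_lattice {..<n}" using a(2) z by auto
  qed
  then have "K = (\<lambda>z. f (c z)) ` int_lattice {..<n}" using A(5) cA by blast
  then show ?thesis using finite_index_image_virtually_free_abelian fin by simp
qed

section \<open>Blind counter automata accepting a word problem\<close>

text \<open>The first time a walk has read all of \<open>u\<close>, it has overshot by at most the label of one edge.\<close>

lemma least_take_covering_prefix:
  assumes w: "concat (map f es) = u @ v"
    and L: "\<And>e. e \<in> set es \<Longrightarrow> length (f e) \<le> L"
    and k: "k = (LEAST k. length u \<le> length (concat (map f (take k es))))"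
  shows "\<exists>r. concat (map f (take k es)) = u @ r \<and> length r \<le> L"
proof -
  let ?c = "\<lambda>k. concat (map f (take k es))"
  have ex: "length u \<le> length (?c (length es))" using w by simp
  have uk: "length u \<le> length (?c k)" unfolding k using ex by (rule LeastI)
  have k_le: "k \<le> length es" unfolding k using ex by (rule Least_le)
  have "length (?c k) \<le> length u + L"
  proof (cases k)
    case 0
    then show ?thesis by simp
  next
    case (Suc k')
    have "k' < (LEAST k. length u \<le> length (?c k))" using Suc k by simp
    then have "\<not> length u \<le> length (?c k')" by (rule not_less_Least)
    moreover have "?c k = ?c k' @ f (es ! k')"
      using Suc k_le by (simp add: take_Suc_conv_app_nth)
    moreover have "length (f (es ! k')) \<le> L" using Suc k_le L by simp
    ultimately show ?thesis by simp
  qed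
  moreover have "?c k @ concat (map f (drop k es)) = u @ v"
    using w by (metis append_take_drop_id concat_append map_append)
  then obtain r where "?c k = u @ r"
    using uk by (auto simp: append_eq_append_conv2)
  ultimately show ?thesis by auto
qed

lemma choice_of_generators_hom:
  assumes "choice_of_generators H S \<sigma>"
  shows "u \<in> lists S \<Longrightarrow> v \<in> lists S \<Longrightarrow> \<sigma> (u @ v) = \<sigma> u \<otimes>\<^bsub>H\<^esub> \<sigma> v"
    and "\<sigma> [] = \<one>\<^bsub>H\<^esub>"
    and "w \<in> lists S \<Longrightarrow> \<sigma> w \<in> carrier H"
    and "h \<in> carrier H \<Longrightarrow> \<exists>w\<in>lists S. \<sigma> w = h"
  using assms unfolding choice_of_generators_def monoid_morphism_def free_monoid_def hom_def
  by (auto simp: image_iff) (metis imageE)+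

locale word_problem_counter_automaton = group H
  for H :: "('h, 'c) monoid_scheme" (structure) +
  fixes S :: "'x set" and \<sigma> :: "'x list \<Rightarrow> 'h" and n :: nat
    and A :: "('q, (nat \<Rightarrow> int) \<times> 'x list) automaton"
  assumes gens: "choice_of_generators H S \<sigma>"
    and aut: "monoid_automaton (Z_power n) S A"
    and accepts: "accepted_language (Z_power n) S A = word_problem H S \<sigma>"
begin

lemmas \<sigma>_append = choice_of_generators_hom(1)[OF gens]
  and \<sigma>_Nil = choice_of_generators_hom(2)[OF gens]
  and \<sigma>_closed = choice_of_generators_hom(3)[OF gens]
  and \<sigma>_surj = choice_of_generators_hom(4)[OF gens]

definition src :: "'q \<times> ((nat \<Rightarrow> int) \<times> 'x list) \<times> 'q \<Rightarrow> 'q" where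
  "src e = fst e"

definition tgt :: "'q \<times> ((nat \<Rightarrow> int) \<times> 'x list) \<times> 'q \<Rightarrow> 'q" where
  "tgt e = snd (snd e)"

definition word :: "'q \<times> ((nat \<Rightarrow> int) \<times> 'x list) \<times> 'q \<Rightarrow> 'x list" where
  "word e = snd (fst (snd e))"

text \<open>Counter changes are stored as functions that are undefined from \<open>n\<close> on. Replacing the undefined
  part by \<open>0\<close> turns them into vectors that can be added pointwise.\<close>

definition cost :: "'q \<times> ((nat \<Rightarrow> int) \<times> 'x list) \<times> 'q \<Rightarrow> nat \<Rightarrow> int" where
  "cost e = (\<lambda>i. if i < n then fst (fst (snd e)) i else 0)"

text \<open>The value \<open>\<one>\<close> off the edge set keeps all values in the carrier of \<open>H\<close>.\<close>

definition val :: "'q \<times> ((nat \<Rightarrow> int) \<times> 'x list) \<times> 'q \<Rightarrow> 'h" where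
  "val e = (if e \<in> edges A then \<sigma> (word e) else \<one>)"

abbreviation label_monoid :: "((nat \<Rightarrow> int) \<times> 'x list) monoid" where
  "label_monoid \<equiv> Z_power n \<times>\<times> free_monoid S"

abbreviation word_of :: "('q \<times> ((nat \<Rightarrow> int) \<times> 'x list) \<times> 'q) list \<Rightarrow> 'x list" where
  "word_of es \<equiv> concat (map word es)"

lemma edge_props:
  assumes "e \<in> edges A"
  shows "tgt e \<in> states A" "word e \<in> lists S"
  using assms aut unfolding monoid_automaton_def finite_automaton_def tgt_def word_def
  by (auto simp: DirProd_def free_monoid_def Z_power_def PiE_def)

lemma val_in_carrier: "val e \<in> carrier H"
  using edge_props(2) \<sigma>_closed by (simp add: val_def)

end

sublocale word_problem_counter_automaton \<subseteq> group_labelled_digraph H "edges A" src tgt cost val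
proof
  show "finite (edges A)" using aut by (simp add: monoid_automaton_def finite_automaton_def)
  show "val e \<in> carrier H" for e by (rule val_in_carrier)
qed

context word_problem_counter_automaton
begin

definition label_of :: "('q \<times> ((nat \<Rightarrow> int) \<times> 'x list) \<times> 'q) list \<Rightarrow> (nat \<Rightarrow> int) \<times> 'x list" where
  "label_of es = (\<lambda>i\<in>{..<n}. total_cost (mset es) i, word_of es)"

lemma one_label_monoid: "\<one>\<^bsub>label_monoid\<^esub> = label_of []"
  by (simp add: label_of_def DirProd_def Z_power_def free_monoid_def)

lemma label_of_Cons: "e \<in> edges A \<Longrightarrow> label_of (e # es) = fst (snd e) \<otimes>\<^bsub>label_monoid\<^esub> label_of es"
  by (cases "fst (snd e)")
    (auto simp: label_of_def DirProd_def Z_power_def free_monoid_def word_def cost_def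
      total_cost_def fun_eq_iff)

lemma labelled_path_iff_walk:
  assumes "p \<in> states A"
  shows "labelled_path label_monoid A p x q \<longleftrightarrow> (\<exists>es. walk p es q \<and> x = label_of es)"
proof
  assume "labelled_path label_monoid A p x q"
  then show "\<exists>es. walk p es q \<and> x = label_of es"
  proof induction
    case (empty_path p)
    then show ?case by (intro exI[of _ "[]"]) (simp only: walk.simps one_label_monoid simp_thms)
  next
    case (edge_path p a q b r)
    then obtain es where es: "walk q es r" "b = label_of es" by blast
    have "walk p ((p, a, q) # es) r" using es(1) edge_path.hyps(1) by (simp add: src_def tgt_def)
    moreover have "a \<otimes>\<^bsub>label_monoid\<^esub> b = label_of ((p, a, q) # es)"
      using label_of_Cons[OF edge_path.hyps(1), of es] es(2) by simp
    ultimately show ?case by blast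
  qed
next
  assume "\<exists>es. walk p es q \<and> x = label_of es"
  then obtain es where es: "walk p es q" "x = label_of es" by blast
  have "labelled_path label_monoid A p (label_of es) q"
    using assms es(1)
  proof (induction es arbitrary: p)
    case Nil
    then have "p = q" "p \<in> states A" by simp_all
    then show ?case using labelled_path.empty_path[of p A label_monoid] by (simp only: one_label_monoid)
  next
    case (Cons e es)
    have e: "e \<in> edges A" "src e = p" "walk (tgt e) es q" using Cons.prems by auto
    have "(p, fst (snd e), tgt e) \<in> edges A" using e by (cases e) (simp add: src_def tgt_def)
    then show ?case
      using labelled_path.edge_path Cons.IH[OF edge_props(1)[OF e(1)] e(3)]
      unfolding label_of_Cons[OF e(1)] by fast
  qed
  then show "labelled_path label_monoid A p x q" using es(2) by simp
qed

lemma word_of_in_lists: "set es \<subseteq> edges A \<Longrightarrow> word_of es \<in> lists S"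
  using edge_props(2) by (induction es) auto

lemma value_of_eq: "set es \<subseteq> edges A \<Longrightarrow> value_of es = \<sigma> (word_of es)"
proof (induction es)
  case Nil
  then show ?case by (simp add: \<sigma>_Nil)
next
  case (Cons e es)
  then have "val e = \<sigma> (word e)" by (simp add: val_def)
  then show ?case
    using Cons \<sigma>_append[OF edge_props(2) word_of_in_lists, of e es] by simp
qed

lemma initial_state: "initial A \<in> states A"
  using aut by (simp add: monoid_automaton_def finite_automaton_def)

lemma total_cost_support: "\<not> i < n \<Longrightarrow> total_cost Z i = 0"
  unfolding total_cost_def by (induction Z) (simp_all add: cost_def)

lemma word_problem_iff_walk:
  assumes "w \<in> lists S"
  shows "\<sigma> w = \<one> \<longleftrightarrow>
    (\<exists>es. \<exists>t\<in>terminals A. walk (initial A) es t \<and> total_cost (mset es) = 0 \<and> word_of es = w)"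
proof -
  have one: "(\<one>\<^bsub>Z_power n\<^esub>, w) = label_of es \<longleftrightarrow> total_cost (mset es) = 0 \<and> word_of es = w" for es
  proof -
    have "\<one>\<^bsub>Z_power n\<^esub> = (\<lambda>i\<in>{..<n}. total_cost (mset es) i) \<longleftrightarrow> total_cost (mset es) = 0"
      using total_cost_support[of _ "mset es"]
      by (auto simp: Z_power_def fun_eq_iff restrict_def split: if_splits)
    then show ?thesis by (auto simp: label_of_def)
  qed
  have "\<sigma> w = \<one> \<longleftrightarrow> w \<in> accepted_language (Z_power n) S A"
    using assms accepts by (simp add: word_problem_def)
  also have "\<dots> \<longleftrightarrow> (\<exists>t\<in>terminals A. \<exists>es. walk (initial A) es t \<and> (\<one>\<^bsub>Z_power n\<^esub>, w) = label_of es)"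
    using assms labelled_path_iff_walk[OF initial_state] by (simp add: accepted_language_def)
  finally show ?thesis using one by blast
qed

text \<open>The automaton accepts a word whose prefixes represent \<open>x 0, \<dots>, x N\<close>, completed by a word for
  \<open>inv (x N)\<close> to one representing the identity.\<close>

lemma walks_track_group_elements:
  fixes x :: "nat \<Rightarrow> 'h"
  assumes x: "\<And>i. x i \<in> carrier H"
    and L: "\<And>e. e \<in> edges A \<Longrightarrow> length (word e) \<le> L"
  shows "\<exists>es k. (\<exists>t\<in>terminals A. walk (initial A) es t \<and> total_cost (mset es) = 0) \<and>
    (\<forall>j\<le>N. \<forall>i\<le>j. k i \<le> k j) \<and>
    (\<forall>i\<le>N. \<exists>d\<in>\<sigma> ` {r \<in> lists S. length r \<le> L}. value_of (take (k i) es) = x i \<otimes> d)"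
proof -
  obtain g where g: "\<And>h. h \<in> carrier H \<Longrightarrow> g h \<in> lists S \<and> \<sigma> (g h) = h"
    using \<sigma>_surj by metis
  define P where "P = rec_nat (g (x 0)) (\<lambda>i u. u @ g (inv (x i) \<otimes> x (Suc i)))"
  have P0: "P 0 = g (x 0)" and PSuc: "P (Suc i) = P i @ g (inv (x i) \<otimes> x (Suc i))" for i
    by (simp_all add: P_def)
  have step: "inv (x i) \<otimes> x (Suc i) \<in> carrier H" for i using x by simp
  have P: "P i \<in> lists S \<and> \<sigma> (P i) = x i" for i
  proof (induction i)
    case 0
    then show ?case using g x P0 by simp
  next
    case (Suc i)
    have "\<sigma> (P (Suc i)) = x i \<otimes> (inv (x i) \<otimes> x (Suc i))"
      using Suc g[OF step[of i]] by (simp add: PSuc \<sigma>_append)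
    also have "\<dots> = x (Suc i)" using x by (simp flip: m_assoc)
    finally show ?case using Suc g[OF step[of i]] PSuc by auto
  qed
  have prefix: "\<exists>v. P j = P i @ v" if "i \<le> j" for i j
    using that by (induction rule: dec_induct) (auto simp: PSuc)
  define w where "w = P N @ g (inv (x N))"
  have gN: "g (inv (x N)) \<in> lists S \<and> \<sigma> (g (inv (x N))) = inv (x N)" using g x by simp
  have "w \<in> lists S" unfolding w_def using P gN by auto
  moreover have "\<sigma> w = \<one>" unfolding w_def using P gN x by (simp add: \<sigma>_append)
  ultimately obtain es t where es: "t \<in> terminals A" "walk (initial A) es t"
      "total_cost (mset es) = 0" "word_of es = w"
    using word_problem_iff_walk by blast
  have es_edges: "set es \<subseteq> edges A" by (rule walk_edges[OF es(2)])
  define k where "k i = (LEAST k. length (P i) \<le> length (word_of (take k es)))" for i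
  have w_prefix: "\<exists>v. word_of es = P i @ v" if "i \<le> N" for i
    using prefix[OF that] es(4) w_def by auto
  have "k i \<le> k j" if ij: "i \<le> j" "j \<le> N" for i j
  proof -
    obtain v where "word_of es = P j @ v" using w_prefix[OF ij(2)] by blast
    then have "length (P j) \<le> length (word_of (take (length es) es))" by simp
    then have "length (P j) \<le> length (word_of (take (k j) es))" unfolding k_def by (rule LeastI)
    moreover have "length (P i) \<le> length (P j)" using prefix[OF ij(1)] by auto
    ultimately show ?thesis unfolding k_def[of i] by (intro Least_le) simp
  qed
  moreover have "\<exists>d\<in>\<sigma> ` {r \<in> lists S. length r \<le> L}. value_of (take (k i) es) = x i \<otimes> d"
    if iN: "i \<le> N" for i
  proof -
    obtain v where v: "word_of es = P i @ v" using w_prefix[OF iN] by blast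
    obtain r where r: "word_of (take (k i) es) = P i @ r" "length r \<le> L"
      using least_take_covering_prefix[OF v L k_def] es_edges by blast
    have te: "set (take (k i) es) \<subseteq> edges A" using es_edges set_take_subset[of "k i" es] by blast
    have "P i @ r \<in> lists S" using word_of_in_lists[OF te] r(1) by simp
    then have rS: "r \<in> lists S" by simp
    have "value_of (take (k i) es) = x i \<otimes> \<sigma> r"
      using value_of_eq[OF te] r(1) P[of i] rS by (simp add: \<sigma>_append)
    then show ?thesis using rS r(2) by blast
  qed
  ultimately show ?thesis using es(1-3) by blast
qed

theorem virtually_free_abelian: "virtually_free_abelian_le H n"
proof -
  have finE: "finite (edges A)" and finT: "finite (terminals A)" and finS: "finite S"
    using aut by (auto simp: monoid_automaton_def finite_automaton_def finite_subset)
  define L where "L = Max (insert 0 ((\<lambda>e. length (word e)) ` edges A))"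
  have L: "length (word e) \<le> L" if "e \<in> edges A" for e
    unfolding L_def using that finE by (intro Max_ge) auto
  let ?D = "\<sigma> ` {r \<in> lists S. length r \<le> L}"
  have "{r \<in> lists S. length r \<le> L} = {r. set r \<subseteq> S \<and> length r \<le> L}" by auto
  then have finD: "finite ?D" using finite_lists_length_le[OF finS] by simp
  interpret abelian_automaton H "edges A" src tgt cost val "initial A" "terminals A" "int_lattice {..<n}"
  proof
    show "finite (terminals A)" by (rule finT)
    show "additive_subgroup (int_lattice {..<n})" by (rule additive_subgroup_int_lattice)
    show "cost e \<in> int_lattice {..<n}" for e by (simp add: cost_def int_lattice_def)
    show "value_of es = \<one>"
      if "walk (initial A) es t" "t \<in> terminals A" "total_cost (mset es) = 0" for es t
    proof -
      have E: "set es \<subseteq> edges A" by (rule walk_edges[OF that(1)])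
      then show ?thesis
        using word_problem_iff_walk[OF word_of_in_lists[OF E]] value_of_eq[OF E] that by auto
    qed
  qed
  interpret tracking_automaton H "edges A" src tgt cost val "initial A" "terminals A" "int_lattice {..<n}" ?D
  proof
    show "finite ?D" by (rule finD)
    show "?D \<subseteq> carrier H" using \<sigma>_closed by auto
    show "\<exists>es k. accepting es \<and> (\<forall>j\<le>N. \<forall>i\<le>j. k i \<le> k j) \<and>
        (\<forall>i\<le>N. \<exists>d\<in>?D. value_of (take (k i) es) = x i \<otimes> d)"
      if "\<And>i::nat. x i \<in> carrier H" for x N
      using walks_track_group_elements[of x L N] that L unfolding accepting_def by blast
  qed
  show ?thesis
    using additive_image_of_finite_index additive_image_virtually_free_abelian by blast
qed

end

section \<open>The coset automaton of a finite-index subgroup\<close>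

text \<open>Any group \<open>M\<close> into which the finite-index subgroup \<open>K\<close> embeds can serve as the register, and \<open>\<iota>\<close>
  leaves the type of states free, which for counter automata is the type of naturals.\<close>

locale coset_automaton = group H + M: group M
  for H :: "('h, 'c) monoid_scheme" (structure)
    and M :: "('m, 'd) monoid_scheme" +
  fixes S :: "'x set" and \<sigma> :: "'x list \<Rightarrow> 'h" and K :: "'h set"
    and \<tau> :: "'h \<Rightarrow> 'm" and \<iota> :: "'h set \<Rightarrow> 'q"
  assumes gens: "choice_of_generators H S \<sigma>"
    and K: "subgroup K H" and finite_index: "finite (rcosets K)"
    and \<tau>_closed: "g \<in> K \<Longrightarrow> \<tau> g \<in> carrier M"
    and \<tau>_mult: "g \<in> K \<Longrightarrow> g' \<in> K \<Longrightarrow> \<tau> (g \<otimes> g') = \<tau> g \<otimes>\<^bsub>M\<^esub> \<tau> g'"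
    and \<tau>_kernel: "g \<in> K \<Longrightarrow> \<tau> g = \<one>\<^bsub>M\<^esub> \<Longrightarrow> g = \<one>"
    and \<iota>: "inj_on \<iota> (rcosets K)"
begin

lemmas \<sigma>_append = choice_of_generators_hom(1)[OF gens]
  and \<sigma>_Nil = choice_of_generators_hom(2)[OF gens]
  and \<sigma>_closed = choice_of_generators_hom(3)[OF gens]

definition rep :: "'h set \<Rightarrow> 'h" where
  "rep c = (SOME g. g \<in> c)"

text \<open>Reading \<open>w\<close> from the coset \<open>c\<close> leads to \<open>c #> \<sigma> w\<close>. Relative to the chosen representatives the word
  deviates from this by an element of \<open>K\<close>, the Schreier cocycle, which the automaton accumulates in
  its register.\<close>

definition deviation :: "'h set \<Rightarrow> 'x list \<Rightarrow> 'h" where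
  "deviation c w = rep c \<otimes> \<sigma> w \<otimes> inv (rep (c #> \<sigma> w))"

definition cosets_automaton :: "('q, 'm \<times> 'x list) automaton" where
  "cosets_automaton = \<lparr>states = \<iota> ` (rcosets K),
     edges = (\<lambda>(c, x). (\<iota> c, (\<tau> (deviation c [x]), [x]), \<iota> (c #> \<sigma> [x]))) ` ((rcosets K) \<times> S),
     initial = \<iota> K, terminals = {\<iota> K}\<rparr>"

abbreviation label_monoid :: "('m \<times> 'x list) monoid" where
  "label_monoid \<equiv> M \<times>\<times> free_monoid S"

lemma K_coset: "K \<in> rcosets K"
  by (rule subgroup.subgroup_in_rcosets[OF K]) (rule is_group)

lemma coset_translate:
  assumes "c \<in> rcosets K" "g \<in> carrier H"
  shows "c #> g \<in> rcosets K"
proof -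
  obtain a where a: "a \<in> carrier H" "c = K #> a" using assms(1) unfolding RCOSETS_def by blast
  have "c #> g = K #> (a \<otimes> g)" using a assms(2) coset_mult_assoc[OF subgroup.subset[OF K]] by simp
  then show ?thesis using a(1) assms(2) unfolding RCOSETS_def by blast
qed

lemma coset_carrier: "c \<in> rcosets K \<Longrightarrow> c \<subseteq> carrier H"
  using subgroup.rcosets_carrier[OF K is_group] .

lemma rep:
  assumes "c \<in> rcosets K"
  shows "rep c \<in> carrier H" "c = K #> rep c"
proof -
  obtain a where a: "a \<in> carrier H" "c = K #> a" using assms unfolding RCOSETS_def by blast
  have "a \<in> c" using rcos_self[OF a(1) K] a(2) by simp
  then have r: "rep c \<in> c" unfolding rep_def by (rule someI)
  then show "rep c \<in> carrier H" using coset_carrier[OF assms] by blast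
  show "c = K #> rep c" using repr_independence[OF _ a(1) K] r a(2) by simp
qed

lemma deviation_in_K:
  assumes c: "c \<in> rcosets K" and w: "w \<in> lists S"
  shows "deviation c w \<in> K"
proof -
  let ?g = "\<sigma> w"
  have g: "?g \<in> carrier H" by (rule \<sigma>_closed[OF w])
  note r = rep[OF c] and r' = rep[OF coset_translate[OF c g]]
  have "K #> (rep c \<otimes> ?g) = c #> ?g"
    using coset_mult_assoc[OF subgroup.subset[OF K] r(1) g] r(2) by simp
  then have "rep c \<otimes> ?g \<in> K #> rep (c #> ?g)"
    using rcos_self[of "rep c \<otimes> ?g", OF _ K] r(1) g r'(2) by auto
  then obtain k where k: "k \<in> K" "rep c \<otimes> ?g = k \<otimes> rep (c #> ?g)" by (auto simp: r_coset_def)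
  have "k \<in> carrier H" using subgroup.mem_carrier[OF K k(1)] .
  then have "deviation c w = k" unfolding deviation_def k(2) using r'(1) by (simp add: m_assoc)
  then show ?thesis using k(1) by simp
qed

lemma deviation_Nil: "c \<in> rcosets K \<Longrightarrow> deviation c [] = \<one>"
  using coset_mult_one[OF coset_carrier] rep(1) by (simp add: deviation_def \<sigma>_Nil)

lemma translate_append:
  assumes "c \<in> rcosets K" "u \<in> lists S" "v \<in> lists S"
  shows "c #> \<sigma> (u @ v) = (c #> \<sigma> u) #> \<sigma> v"
  using coset_mult_assoc[OF coset_carrier[OF assms(1)] \<sigma>_closed[OF assms(2)] \<sigma>_closed[OF assms(3)]]
    \<sigma>_append[OF assms(2,3)] by simp

lemma deviation_append:
  assumes c: "c \<in> rcosets K" and u: "u \<in> lists S" and v: "v \<in> lists S"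
  shows "deviation c (u @ v) = deviation c u \<otimes> deviation (c #> \<sigma> u) v"
proof -
  have cl: "rep c \<in> carrier H" "rep (c #> \<sigma> u) \<in> carrier H" "rep ((c #> \<sigma> u) #> \<sigma> v) \<in> carrier H"
    "\<sigma> u \<in> carrier H" "\<sigma> v \<in> carrier H"
    using rep(1) c coset_translate \<sigma>_closed[OF u] \<sigma>_closed[OF v] by auto
  have "inv (rep (c #> \<sigma> u)) \<otimes> (rep (c #> \<sigma> u) \<otimes> (\<sigma> v \<otimes> inv (rep ((c #> \<sigma> u) #> \<sigma> v))))
      = \<sigma> v \<otimes> inv (rep ((c #> \<sigma> u) #> \<sigma> v))"
    using cl by (simp flip: m_assoc)
  then show ?thesis
    unfolding deviation_def translate_append[OF assms]
    unfolding \<sigma>_append[OF u v]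
    using cl by (simp add: m_assoc)
qed

lemma \<tau>_one: "\<tau> \<one> = \<one>\<^bsub>M\<^esub>"
proof -
  have K1: "\<one> \<in> K" by (rule subgroup.one_closed[OF K])
  have "\<tau> \<one> \<otimes>\<^bsub>M\<^esub> \<tau> \<one> = \<tau> \<one>" using \<tau>_mult[OF K1 K1] by simp
  then show ?thesis using \<tau>_closed[OF K1] by simp
qed

lemma label_one: "\<one>\<^bsub>label_monoid\<^esub> = (\<one>\<^bsub>M\<^esub>, [])"
  by (simp add: DirProd_def free_monoid_def)

lemma label_mult: "a \<otimes>\<^bsub>label_monoid\<^esub> b = (fst a \<otimes>\<^bsub>M\<^esub> fst b, snd a @ snd b)"
  by (cases a, cases b) (simp add: DirProd_def free_monoid_def)

lemma path_reads_deviation: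
  assumes "labelled_path label_monoid cosets_automaton p a q" "c \<in> rcosets K" "p = \<iota> c"
  shows "snd a \<in> lists S \<and> q = \<iota> (c #> \<sigma> (snd a)) \<and> fst a = \<tau> (deviation c (snd a))"
  using assms
proof (induction arbitrary: c)
  case (empty_path p)
  then show ?case
    unfolding label_one using coset_mult_one[OF coset_carrier] by (simp add: deviation_Nil \<sigma>_Nil \<tau>_one)
next
  case (edge_path p a q b r)
  obtain c' x where e: "c' \<in> rcosets K" "x \<in> S" "p = \<iota> c'"
      "a = (\<tau> (deviation c' [x]), [x])" "q = \<iota> (c' #> \<sigma> [x])"
    using edge_path.hyps(1) by (auto simp: cosets_automaton_def)
  have c': "c' = c" using inj_onD[OF \<iota>, of c' c] e edge_path.prems by simp
  have x: "[x] \<in> lists S" using e(2) by simp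
  let ?c = "c #> \<sigma> [x]"
  have cK: "?c \<in> rcosets K" by (rule coset_translate[OF edge_path.prems(1) \<sigma>_closed[OF x]])
  have IH: "snd b \<in> lists S" "r = \<iota> (?c #> \<sigma> (snd b))" "fst b = \<tau> (deviation ?c (snd b))"
    using edge_path.IH[OF cK] e(5) c' by auto
  note cxb = edge_path.prems(1) x IH(1)
  have "\<tau> (deviation c ([x] @ snd b)) = \<tau> (deviation c [x]) \<otimes>\<^bsub>M\<^esub> fst b"
    unfolding deviation_append[OF cxb] IH(3)
    using \<tau>_mult deviation_in_K[OF edge_path.prems(1) x] deviation_in_K[OF cK IH(1)] by blast
  moreover have "r = \<iota> (c #> \<sigma> ([x] @ snd b))" using IH(2) translate_append[OF cxb] by simp
  ultimately show ?case
    unfolding label_mult e(4) c' using x IH(1) by simp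
qed

lemma path_reading_word:
  assumes "w \<in> lists S" "c \<in> rcosets K"
  shows "labelled_path label_monoid cosets_automaton (\<iota> c) (\<tau> (deviation c w), w) (\<iota> (c #> \<sigma> w))"
  using assms
proof (induction w arbitrary: c rule: list.induct)
  case Nil
  have "\<iota> c \<in> states cosets_automaton" using Nil by (simp add: cosets_automaton_def)
  from labelled_path.empty_path[OF this, of label_monoid] show ?case
    unfolding label_one using coset_mult_one[OF coset_carrier[OF Nil(2)]] Nil(2)
    by (simp add: deviation_Nil \<sigma>_Nil \<tau>_one)
next
  case (Cons x w)
  have x: "[x] \<in> lists S" and w: "w \<in> lists S" using Cons.prems(1) by simp_all
  let ?c = "c #> \<sigma> [x]"
  have cK: "?c \<in> rcosets K" by (rule coset_translate[OF Cons.prems(2) \<sigma>_closed[OF x]])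
  have edge: "(\<iota> c, (\<tau> (deviation c [x]), [x]), \<iota> ?c) \<in> edges cosets_automaton"
    unfolding cosets_automaton_def using Cons.prems x by (auto intro!: image_eqI[of _ _ "(c, x)"])
  have "(\<tau> (deviation c (x # w)), x # w) =
      (\<tau> (deviation c [x]), [x]) \<otimes>\<^bsub>label_monoid\<^esub> (\<tau> (deviation ?c w), w)"
    unfolding label_mult
    using \<tau>_mult[OF deviation_in_K[OF Cons.prems(2) x] deviation_in_K[OF cK w]]
      deviation_append[OF Cons.prems(2) x w] by simp
  moreover have "c #> \<sigma> (x # w) = ?c #> \<sigma> w" using translate_append[OF Cons.prems(2) x w] by simp
  ultimately show ?case
    using labelled_path.edge_path[OF edge Cons.IH[OF w cK]] by (simp only:)
qed

lemma monoid_automaton_cosets: "monoid_automaton M S cosets_automaton"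
proof -
  have S: "finite S" using gens by (simp add: choice_of_generators_def)
  have "edges cosets_automaton \<subseteq>
      states cosets_automaton \<times> carrier label_monoid \<times> states cosets_automaton"
  proof
    fix e
    assume "e \<in> edges cosets_automaton"
    then obtain c x where e: "c \<in> rcosets K" "x \<in> S"
        "e = (\<iota> c, (\<tau> (deviation c [x]), [x]), \<iota> (c #> \<sigma> [x]))"
      by (auto simp: cosets_automaton_def)
    have x: "[x] \<in> lists S" using e(2) by simp
    show "e \<in> states cosets_automaton \<times> carrier label_monoid \<times> states cosets_automaton"
      using e x coset_translate[OF e(1) \<sigma>_closed[OF x]] \<tau>_closed[OF deviation_in_K[OF e(1) x]]
      by (simp add: cosets_automaton_def DirProd_def free_monoid_def)
  qed
  then show ?thesis
    unfolding monoid_automaton_def finite_automaton_def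
    using S finite_index K_coset by (simp add: cosets_automaton_def)
qed

lemma accepted_language_cosets: "accepted_language M S cosets_automaton = word_problem H S \<sigma>"
proof -
  have "labelled_path label_monoid cosets_automaton (\<iota> K) (\<one>\<^bsub>M\<^esub>, w) (\<iota> K) \<longleftrightarrow> \<sigma> w = \<one>"
    if w: "w \<in> lists S" for w
  proof
    note dev = deviation_in_K[OF K_coset w] and g = \<sigma>_closed[OF w] and r = rep(1)[OF K_coset]
    assume "labelled_path label_monoid cosets_automaton (\<iota> K) (\<one>\<^bsub>M\<^esub>, w) (\<iota> K)"
    then have p: "\<iota> K = \<iota> (K #> \<sigma> w)" "\<one>\<^bsub>M\<^esub> = \<tau> (deviation K w)"
      using path_reads_deviation[OF _ K_coset, of "\<iota> K" "(\<one>\<^bsub>M\<^esub>, w)"] by auto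
    have "K = K #> \<sigma> w" using inj_onD[OF \<iota> p(1) K_coset coset_translate[OF K_coset g]] .
    moreover have "deviation K w = \<one>" using \<tau>_kernel[OF dev] p(2) by simp
    ultimately have "rep K \<otimes> \<sigma> w \<otimes> inv (rep K) = \<one>" by (simp add: deviation_def)
    then have "rep K \<otimes> \<sigma> w = \<one> \<otimes> rep K"
      using r g inv_solve_right'[of \<one> "rep K \<otimes> \<sigma> w" "rep K"] by simp
    then show "\<sigma> w = \<one>" using r g by simp
  next
    assume 1: "\<sigma> w = \<one>"
    have "K #> \<one> = K" by (rule coset_mult_one[OF coset_carrier[OF K_coset]])
    moreover have "deviation K w = \<one>"
      using 1 \<open>K #> \<one> = K\<close> rep(1)[OF K_coset] by (simp add: deviation_def)
    ultimately show "labelled_path label_monoid cosets_automaton (\<iota> K) (\<one>\<^bsub>M\<^esub>, w) (\<iota> K)"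
      using path_reading_word[OF w K_coset] 1 by (simp add: \<tau>_one)
  qed
  then show ?thesis
    unfolding accepted_language_def word_problem_def by (auto simp: cosets_automaton_def)
qed

end

section \<open>Word problems of blind counter automata\<close>

text \<open>Take the coset automaton of a finite-index subgroup isomorphic to \<open>\<int>\<^sup>k\<close>. Its counters hold the
  image of the Schreier cocycle in \<open>\<int>\<^sup>k\<close>, padded with zeros to \<open>n\<close> counters.\<close>

lemma virtually_free_abelian_accepted:
  assumes "group H" and gens: "choice_of_generators H S \<sigma>" and vfa: "virtually_free_abelian_le H n"
  shows "blind_counter_language n S (word_problem H S \<sigma>)"
proof -
  interpret group H by fact
  obtain k K where k: "k \<le> n" and K: "subgroup K H" "finite (rcosets\<^bsub>H\<^esub> K)"
    and "H\<lparr>carrier := K\<rparr> \<cong> Z_power k"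
    using vfa unfolding virtually_free_abelian_le_def by blast
  then obtain \<theta> where \<theta>: "\<theta> \<in> iso (H\<lparr>carrier := K\<rparr>) (Z_power k)" unfolding is_iso_def by blast
  have \<theta>_carrier: "\<theta> g \<in> (\<Pi>\<^sub>E i\<in>{..<k}. UNIV)" if "g \<in> K" for g
    using \<theta> that by (auto simp: iso_def hom_def Z_power_def)
  have \<theta>_mult: "\<theta> (g \<otimes>\<^bsub>H\<^esub> g') = (\<lambda>i\<in>{..<k}. \<theta> g i + \<theta> g' i)" if "g \<in> K" "g' \<in> K" for g g'
    using \<theta> that by (auto simp: iso_def hom_def Z_power_def)
  have \<theta>_inj: "inj_on \<theta> K" using \<theta> by (auto simp: iso_def bij_betw_def)
  define \<tau> where "\<tau> g = (\<lambda>i\<in>{..<n}. if i < k then \<theta> g i else 0)" for g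
  obtain \<iota> :: "'a set \<Rightarrow> nat" where \<iota>: "inj_on \<iota> (rcosets\<^bsub>H\<^esub> K)"
    using finite_imp_inj_to_nat_seg[OF K(2)] by auto
  have K1: "\<one>\<^bsub>H\<^esub> \<in> K" by (rule subgroup.one_closed[OF K(1)])
  interpret coset_automaton H "Z_power n" S \<sigma> K \<tau> \<iota>
  proof (intro coset_automaton.intro coset_automaton_axioms.intro)
    show "group H" by fact
    show "group (Z_power n)" unfolding Z_power_def by simp
    show "\<tau> g \<in> carrier (Z_power n)" for g by (simp add: \<tau>_def Z_power_def)
    show "\<tau> (g \<otimes>\<^bsub>H\<^esub> g') = \<tau> g \<otimes>\<^bsub>Z_power n\<^esub> \<tau> g'" if "g \<in> K" "g' \<in> K" for g g'
      using \<theta>_mult[OF that] by (auto simp: \<tau>_def Z_power_def fun_eq_iff)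
    show "g = \<one>\<^bsub>H\<^esub>" if g: "g \<in> K" and "\<tau> g = \<one>\<^bsub>Z_power n\<^esub>" for g
    proof -
      have zero: "\<theta> g i = 0" if "i < k" for i
        using fun_cong[OF \<open>\<tau> g = \<one>\<^bsub>Z_power n\<^esub>\<close>, of i] that k by (simp add: \<tau>_def Z_power_def)
      have "\<theta> (g \<otimes>\<^bsub>H\<^esub> g) = \<theta> g"
      proof (rule PiE_ext)
        show "\<theta> (g \<otimes>\<^bsub>H\<^esub> g) \<in> (\<Pi>\<^sub>E i\<in>{..<k}. UNIV)" "\<theta> g \<in> (\<Pi>\<^sub>E i\<in>{..<k}. UNIV)"
          using \<theta>_carrier g subgroup.m_closed[OF K(1) g g] by auto
        show "\<theta> (g \<otimes>\<^bsub>H\<^esub> g) i = \<theta> g i" if "i \<in> {..<k}" for i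
          using \<theta>_mult[OF g g] zero that by simp
      qed
      then have "g \<otimes>\<^bsub>H\<^esub> g = g"
        using inj_onD[OF \<theta>_inj] g subgroup.m_closed[OF K(1) g g] by blast
      then show ?thesis using subgroup.mem_carrier[OF K(1) g] by simp
    qed
  qed (fact gens K \<iota>)+
  show ?thesis
    unfolding blind_counter_language_def
    using monoid_automaton_cosets accepted_language_cosets by blast
qed

theorem theorem1:
  fixes H :: "('h, 'c) monoid_scheme"
    and S :: "'x set"
    and \<sigma> :: "'x list \<Rightarrow> 'h"
    and n :: nat
  assumes "group H"
    and "choice_of_generators H S \<sigma>"
  shows "blind_counter_language n S (word_problem H S \<sigma>) \<longleftrightarrow> virtually_free_abelian_le H n"
proof
  assume "blind_counter_language n S (word_problem H S \<sigma>)"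
  then obtain A :: "(nat, (nat \<Rightarrow> int) \<times> 'x list) automaton"
    where "monoid_automaton (Z_power n) S A"
      and "accepted_language (Z_power n) S A = word_problem H S \<sigma>"
    unfolding blind_counter_language_def by blast
  then have "word_problem_counter_automaton H S \<sigma> n A"
    using assms by (intro word_problem_counter_automaton.intro word_problem_counter_automaton_axioms.intro)
  then show "virtually_free_abelian_le H n"
    by (rule word_problem_counter_automaton.virtually_free_abelian)
next
  assume "virtually_free_abelian_le H n"
  then show "blind_counter_language n S (word_problem H S \<sigma>)"
    by (rule virtually_free_abelian_accepted[OF assms])
qed

end
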